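(* Let $D\subset\mathbf R^2$ be a bounded domain and let $V\in L\log L(D)$ be real-valued. Assume that the equation $-\Delta u=Vu$ in $D$ has a nontrivial distributional solution $u\in W^{1,2}_0(D)$. Then $$\frac{C_2|D|}{4\pi}\,\|V_+\|_{N_D}\ \ge\ 1,$$ where $C_2$ is the constant of the Moser–Trudinger inequality. Moreover, let $u_*$ be an extremal for the Moser–Trudinger inequality on $D$, normalized by $\|\nabla u_*\|_2=1$. Then for $$V(x)=\frac{e^{4\pi|u_*(x)|^2}}{\int_D|u_*(y)|^2e^{4\pi|u_*(y)|^2}\,dy}$$ equality holds: $\frac{C_2|D|}{4\pi}\|V_+\|_{N_D}=1$.
   Context: $W^{1,2}_0(D)$ is the closure of $C_0^\infty(D)$ with respect to $\|\nabla u\|_2$. $V_+=\max\{V,0\}$. $L\log L(D)$ is the set of measurable $f$ with $\int_D|f|(1+\log^+|f|)\,dx<\infty$. The Moser–Trudinger inequality is $$\int_D\Big(e^{4\pi(|u(x)|/\|\nabla u\|_2)^2}-1\Big)dx\le C_2|D|,\qquad u\in W^{1,2}_0(D),\ u\neq0,$$ where the constant $C_2$ does not depend on $u$ or $D$; an extremal is a nonzero $u_*\in W_0^{1,2}(D)$ for which equality holds in this inequality. Let $N(y)=y\log y-y+1$ for $y\ge1$ and $N(y)=0$ otherwise. For $f\in L\log L(D)$, $$\|f\|_{N_D}=\inf_{\lambda>0}\Big\{\lambda+\frac{\lambda}{C_2|D|}\int_DN\Big(\frac{|f(x)|}{\lambda}\Big)dx\Big\}.$$ Distributional solution means $\int_D\nabla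 u\cdot\nabla\psi\,dx=\int_DVu\psi\,dx$ for all $\psi\in C_0^\infty(D)$; nontrivial means not a.e. zero. *)

theory Defs
  imports "HOL-Analysis.Analysis"
begin

type_synonym plane = "real^2"

definition bounded_domain :: "plane set \<Rightarrow> bool" where
  "bounded_domain D \<longleftrightarrow> open D \<and> connected D \<and> D \<noteq> {} \<and> bounded D"


subsection \<open>Test functions\<close>

text \<open>
  The scalars are a type of sort \<open>{real_normed_field, euclidean_space}\<close>, which has exactly the
  instances \<open>real\<close> and \<open>complex\<close> up to isomorphism, so real-valued and complex-valued functions
  are treated simultaneously. On the gradient type \<open>'a^2\<close> the norm is the Euclidean one,
  \<open>(\<bar>g\<^sub>1\<bar>\<^sup>2 + \<bar>g\<^sub>2\<bar>\<^sup>2)\<^sup>1\<^sup>/\<^sup>2\<close>.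
\<close>

definition partial :: "2 \<Rightarrow> (plane \<Rightarrow> 'a::real_normed_vector) \<Rightarrow> plane \<Rightarrow> 'a" where
  "partial i f x = frechet_derivative f (at x) (axis i 1)"

text \<open>
  A function is \<open>C\<^sup>\<infinity>\<close> iff every iterated partial derivative is (totally) differentiable
  everywhere; continuity of all partial derivatives is then automatic.
\<close>

definition smooth :: "(plane \<Rightarrow> 'a::real_normed_vector) \<Rightarrow> bool" where
  "smooth f \<longleftrightarrow> (\<forall>is. foldr partial is f differentiable_on UNIV)"

definition grad :: "(plane \<Rightarrow> 'a::real_normed_vector) \<Rightarrow> plane \<Rightarrow> 'a^2" where
  "grad f x = (\<chi> i. partial i f x)"

text \<open>Elements of \<open>C\<^sub>0\<^sup>\<infinity>(D)\<close> are represented by their extension by zero to the plane.\<close>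

definition test_functions :: "plane set \<Rightarrow> (plane \<Rightarrow> 'a::real_normed_vector) set" where
  "test_functions D =
    {\<psi>. smooth \<psi> \<and> compact (closure {x. \<psi> x \<noteq> 0}) \<and> closure {x. \<psi> x \<noteq> 0} \<subseteq> D}"


subsection \<open>The Sobolev space $W^{1,2}_0(D)$\<close>

definition L2_space :: "plane set \<Rightarrow> (plane \<Rightarrow> 'b::euclidean_space) set" where
  "L2_space D = {f \<in> borel_measurable (lebesgue_on D).
                   integrable (lebesgue_on D) (\<lambda>x. (norm (f x))\<^sup>2)}"

definition L2_norm :: "plane set \<Rightarrow> (plane \<Rightarrow> 'b::euclidean_space) \<Rightarrow> real" where
  "L2_norm D f = sqrt (\<integral>x. (norm (f x))\<^sup>2 \<partial>lebesgue_on D)"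

text \<open>
  The completion of \<open>C\<^sub>0\<^sup>\<infinity>(D)\<close> with respect to \<open>\<parallel>\<nabla>u\<parallel>\<^sub>2\<close> is realised as a space of functions:
  for bounded \<open>D\<close> the Poincare inequality shows that if \<open>\<nabla>\<phi>\<^sub>n\<close> converges in \<open>L\<^sup>2(D)\<close>, then so
  does \<open>\<phi>\<^sub>n\<close>. Thus \<open>u\<close> belongs to the closure, with gradient \<open>g\<close>, iff \<open>(\<phi>\<^sub>n, \<nabla>\<phi>\<^sub>n) \<rightarrow> (u, g)\<close>
  in \<open>L\<^sup>2(D)\<close> for some test functions \<open>\<phi>\<^sub>n\<close>. Convergence of the gradients alone would not
  determine \<open>u\<close>, as it does not see constants.
\<close>

definition W012_limit ::
  "plane set \<Rightarrow> (plane \<Rightarrow> 'a::euclidean_space) \<Rightarrow> (plane \<Rightarrow> 'a^2) \<Rightarrow> bool" where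
  "W012_limit D u g \<longleftrightarrow> u \<in> L2_space D \<and> g \<in> L2_space D \<and>
    (\<exists>\<phi>. (\<forall>n::nat. \<phi> n \<in> test_functions D) \<and>
         (\<lambda>n. L2_norm D (\<lambda>x. \<phi> n x - u x)) \<longlonglongrightarrow> 0 \<and>
         (\<lambda>n. L2_norm D (\<lambda>x. grad (\<phi> n) x - g x)) \<longlonglongrightarrow> 0)"

definition W012 :: "plane set \<Rightarrow> (plane \<Rightarrow> 'a::euclidean_space) set" where
  "W012 D = {u. \<exists>g. W012_limit D u g}"

text \<open>
  Integration by parts shows that a limit \<open>g\<close> as above is the weak gradient of \<open>u\<close>, hence is
  unique up to null sets; the choice below picks a representative.
\<close>

definition wgrad :: "plane set \<Rightarrow> (plane \<Rightarrow> 'a::euclidean_space) \<Rightarrow> plane \<Rightarrow> 'a^2" where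
  "wgrad D u = (SOME g. W012_limit D u g)"

definition dirichlet_norm :: "plane set \<Rightarrow> (plane \<Rightarrow> 'a::euclidean_space) \<Rightarrow> real" where
  "dirichlet_norm D u = L2_norm D (wgrad D u)"

definition nontrivial :: "plane set \<Rightarrow> (plane \<Rightarrow> 'a::zero) \<Rightarrow> bool" where
  "nontrivial D u \<longleftrightarrow> \<not> (AE x in lebesgue_on D. u x = 0)"

text \<open>
  \<open>-\<Delta>u = Vu\<close> in \<open>D\<close>. The dot product of gradients is the bilinear one (no conjugation).
\<close>

definition distributional_solution ::
  "plane set \<Rightarrow> (plane \<Rightarrow> real) \<Rightarrow> (plane \<Rightarrow> 'a::{real_normed_field, euclidean_space}) \<Rightarrow> bool"
  where
  "distributional_solution D V u \<longleftrightarrow>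
    (\<forall>\<psi>\<in>test_functions D.
      (\<integral>x. (\<Sum>i\<in>UNIV. wgrad D u x $ i * grad \<psi> x $ i) \<partial>lebesgue_on D) =
      (\<integral>x. V x *\<^sub>R (u x * \<psi> x) \<partial>lebesgue_on D))"


subsection \<open>The Moser--Trudinger inequality\<close>

text \<open>
  Using the nonnegative integral, the inequality includes the finiteness of the left-hand side.
\<close>

definition MT_integral :: "plane set \<Rightarrow> (plane \<Rightarrow> 'a::euclidean_space) \<Rightarrow> ennreal" where
  "MT_integral D u =
    (\<integral>\<^sup>+x. ennreal (exp (4 * pi * (norm (u x) / dirichlet_norm D u)\<^sup>2) - 1) \<partial>lebesgue_on D)"

definition MT_extremal :: "real \<Rightarrow> plane set \<Rightarrow> (plane \<Rightarrow> 'a::euclidean_space) \<Rightarrow> bool" where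
  "MT_extremal C\<^sub>2 D u \<longleftrightarrow>
    u \<in> W012 D \<and> nontrivial D u \<and> MT_integral D u = ennreal (C\<^sub>2 * measure lebesgue D)"


subsection \<open>The space $L\log L(D)$ and its norm\<close>

definition LlogL :: "plane set \<Rightarrow> (plane \<Rightarrow> real) set" where
  "LlogL D = {f \<in> borel_measurable (lebesgue_on D).
                integrable (lebesgue_on D) (\<lambda>x. \<bar>f x\<bar> * (1 + max 0 (ln \<bar>f x\<bar>)))}"

definition young_N :: "real \<Rightarrow> real" where
  "young_N y = (if y \<ge> 1 then y * ln y - y + 1 else 0)"

definition LlogL_norm :: "real \<Rightarrow> plane set \<Rightarrow> (plane \<Rightarrow> real) \<Rightarrow> real" where
  "LlogL_norm C\<^sub>2 D f =
    (INF t\<in>{0<..}. t + t / (C\<^sub>2 * measure lebesgue D) *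
                      (\<integral>x. young_N (\<bar>f x\<bar> / t) \<partial>lebesgue_on D))"

definition pos_part :: "(plane \<Rightarrow> real) \<Rightarrow> plane \<Rightarrow> real" where
  "pos_part V x = max (V x) 0"

definition extremal_potential :: "plane set \<Rightarrow> (plane \<Rightarrow> 'a::euclidean_space) \<Rightarrow> plane \<Rightarrow> real"
  where
  "extremal_potential D u x =
    exp (4 * pi * (norm (u x))\<^sup>2) /
      (\<integral>y. (norm (u y))\<^sup>2 * exp (4 * pi * (norm (u y))\<^sup>2) \<partial>lebesgue_on D)"

end

theory Submission
  imports Defs
begin

text \<open>
  Testing the equation with \<open>u\<close> itself gives \<open>\<parallel>\<nabla>u\<parallel>\<^sub>2\<^sup>2 = \<integral> V \<bar>u\<bar>\<^sup>2 \<le> \<integral> V\<^sub>+ \<bar>u\<bar>\<^sup>2\<close>. The function \<open>N\<close> is the Young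
  conjugate of \<open>e\<^sup>b - 1\<close>, so \<open>a b \<le> N a + e\<^sup>b - 1\<close>; with \<open>a = V\<^sub>+ / t\<close>,
  \<open>b = 4 \<pi> \<bar>u\<bar>\<^sup>2 / \<parallel>\<nabla>u\<parallel>\<^sub>2\<^sup>2\<close> the Moser--Trudinger inequality bounds the right-hand side by
  \<open>\<parallel>\<nabla>u\<parallel>\<^sub>2\<^sup>2 t / (4 \<pi>) (\<integral> N (V\<^sub>+ / t) + C\<^sub>2 \<bar>D\<bar>)\<close>, for every \<open>t > 0\<close>. For an extremal and
  \<open>1 / t = \<integral> \<bar>u\<bar>\<^sup>2 e\<^bsup>4\<pi>\<bar>u\<bar>\<^sup>2\<^esup>\<close>, both the Young and the Moser--Trudinger inequality are equalities.
  That last integral is finite because \<open>e\<^bsup>p\<bar>u\<bar>\<^sup>2\<^esup>\<close> is integrable for every \<open>p\<close>.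
\<close>

subsection \<open>Integration by parts and $L^2$ spaces\<close>

text \<open>The delicate point is testing with \<open>u\<close>: the equation admits only smooth
  test functions, and since \<open>V\<close> is merely in L log L, convergence
  \<open>phi_n -> u\<close> in \<open>L^2\<close> does not control \<open>V u phi_n\<close>. The way
  out is to use the Young and Moser--Trudinger inequalities a second time, now with weight
  \<open>|V|\<close>: they bound the integral of \<open>|V| |w|^2\<close> by a constant times the
  squared Dirichlet norm of \<open>w\<close>, so the weighted form is continuous along the
  approximating sequence. The gradient of \<open>u\<close> is picked by choice and the
  Moser--Trudinger exponent divides by its norm. Hence gradient limits must be unique up to null
  sets, and a vanishing gradient must force \<open>u = 0\<close>; integration by parts and a
  Poincare inequality supply this. In the equality case no differential equation for the extremal is
  used: the normalisation of the potential makes the integral of \<open>V |u|^2\<close> equal to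
  \<open>1\<close>, the squared Dirichlet norm, and this energy relation is all that the lower bound
  asks for.\<close>

lemma partial_eqI: "(f has_derivative f') (at x) \<Longrightarrow> partial i f x = f' (axis i 1)"
  by (metis frechet_derivative_at partial_def)

text \<open>By translation invariance of Lebesgue measure every difference quotient in direction
  \<open>i\<close> integrates to 0; dominated convergence carries this over to the
  derivative.\<close>

lemma integral_partial_eq_0:
  fixes f :: "plane \<Rightarrow> real"
  assumes diff: "f differentiable_on UNIV"
    and cont: "continuous_on UNIV (partial i f)"
    and bdd: "bounded {x. f x \<noteq> 0}"
  shows "(\<integral>x. partial i f x \<partial>lborel) = 0"
proof -
  let ?e = "axis i 1 :: plane"
  have der: "(f has_derivative frechet_derivative f (at x)) (at x)" for x
    using diff by (simp add: differentiable_on_def frechet_derivative_works)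
  have contf: "continuous_on UNIV f"
    using diff by (rule differentiable_imp_continuous_on)
  obtain r where r: "r > 0" "\<And>x. f x \<noteq> 0 \<Longrightarrow> norm x < r"
    using bdd unfolding bounded_pos_less by auto
  have p0: "partial i f x = 0" if "norm x > r" for x
  proof -
    have "(f has_derivative (\<lambda>_. 0)) (at x)"
    proof (rule has_derivative_transform_within_open[of "\<lambda>_. 0" _ _ _ "- cball 0 r"])
      show "open (- cball 0 r :: plane set)" by auto
    qed (use that r in \<open>force\<close>)+
    thus ?thesis by (simp add: partial_eqI)
  qed
  have "bounded (partial i f ` cball 0 r)"
    by (intro compact_imp_bounded compact_continuous_image) (use cont continuous_on_subset in auto)
  then obtain M where M: "\<And>x. norm x \<le> r \<Longrightarrow> \<bar>partial i f x\<bar> \<le> M" "M > 0"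
    unfolding bounded_pos by (metis imageI mem_cball_0 real_norm_def)
  have M': "\<bar>partial i f x\<bar> \<le> M" for x
    using M p0[of x] by (cases "norm x \<le> r") auto
  have derl: "((\<lambda>t. f (x + t *\<^sub>R ?e)) has_real_derivative partial i f (x + t *\<^sub>R ?e)) (at t)" for x t
  proof -
    have "((\<lambda>t. f (x + t *\<^sub>R ?e)) has_derivative
            (\<lambda>s. frechet_derivative f (at (x + t *\<^sub>R ?e)) (s *\<^sub>R ?e))) (at t)"
      by (rule has_derivative_compose[of "\<lambda>t. x + t *\<^sub>R ?e" "\<lambda>s. s *\<^sub>R ?e" t UNIV f, OF _ der])
        (auto intro!: derivative_eq_intros)
    moreover have "linear (frechet_derivative f (at (x + t *\<^sub>R ?e)))"
      using der has_derivative_linear by blast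
    ultimately show ?thesis
      by (simp add: has_field_derivative_def partial_def linear_scale mult.commute[of _ "frechet_derivative _ _ _"])
  qed
  \<comment> \<open>Step lengths of at most 1 keep all difference quotients supported in the ball of
    radius \<open>r + 1\<close>. The mean value theorem bounds them there by \<open>M\<close>, so
    one integrable majorant serves for all \<open>n\<close>.\<close>
  define h where "h n = 1 / real (Suc n)" for n
  have h: "h n > 0" "h n \<le> 1" for n by (auto simp: h_def)
  define s where "s n x = (f (x + h n *\<^sub>R ?e) - f x) / h n" for n x
  have sb: "norm (s n x) \<le> M * indicator (cball 0 (r+1)) x" for n x
  proof (cases "x \<in> cball 0 (r+1)")
    case True
    obtain z where "f (x + h n *\<^sub>R ?e) - f (x + 0 *\<^sub>R ?e) = (h n - 0) * partial i f (x + z *\<^sub>R ?e)"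
      using MVT2[of 0 "h n" "\<lambda>t. f (x + t *\<^sub>R ?e)" "\<lambda>t. partial i f (x + t *\<^sub>R ?e)", OF h(1) derl]
      by blast
    thus ?thesis using True h[of n] M' by (simp add: s_def)
  next
    case False
    hence n: "norm x > r + 1" by auto
    have "norm (x + h n *\<^sub>R ?e) \<ge> norm x - norm (h n *\<^sub>R ?e)" by (metis norm_diff_ineq)
    moreover have "norm (h n *\<^sub>R ?e) \<le> 1" using h[of n] by (simp add: norm_axis_1)
    ultimately have "f (x + h n *\<^sub>R ?e) = 0" "f x = 0" using n r(2)[of x] r(2)[of "x + h n *\<^sub>R ?e"] r(1) by linarith+
    thus ?thesis using False by (simp add: s_def)
  qed
  have intf: "integrable lborel f"
  proof -
    have "set_integrable lborel (cball 0 r) f"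
      unfolding set_integrable_def
      by (rule borel_integrable_compact) (use contf continuous_on_subset in auto)
    moreover have "(\<lambda>x. indicator (cball 0 r) x *\<^sub>R f x) = f"
      using r(2) by (force simp: indicator_def)
    ultimately show ?thesis by (simp add: set_integrable_def)
  qed
  have shift: "integrable lborel (\<lambda>x. f (x + c))" "(\<integral>x. f (x + c) \<partial>lborel) = (\<integral>x. f x \<partial>lborel)" for c
  proof -
    have "integrable (distr lborel borel ((+) c)) f" using intf by (simp add: lborel_distr_plus)
    thus "integrable lborel (\<lambda>x. f (x + c))" by (subst (asm) integrable_distr_eq) (use contf in \<open>auto simp: borel_measurable_continuous_onI add.commute\<close>)
    have "(\<integral>x. f x \<partial>lborel) = (\<integral>x. f x \<partial>distr lborel borel ((+) c))" by (simp add: lborel_distr_plus)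
    also have "\<dots> = (\<integral>x. f (x + c) \<partial>lborel)" by (subst integral_distr) (use contf in \<open>auto simp: borel_measurable_continuous_onI add.commute\<close>)
    finally show "(\<integral>x. f (x + c) \<partial>lborel) = (\<integral>x. f x \<partial>lborel)" by simp
  qed
  have "(\<integral>x. s n x \<partial>lborel) = 0" for n
    unfolding s_def using shift intf by simp
  moreover have "(\<lambda>n. \<integral>x. s n x \<partial>lborel) \<longlonglongrightarrow> (\<integral>x. partial i f x \<partial>lborel)"
  proof (rule integral_dominated_convergence[where w = "\<lambda>x. M * indicator (cball 0 (r+1)) x"])
    show "partial i f \<in> borel_measurable lborel" using cont by (simp add: borel_measurable_continuous_onI)
    show "s n \<in> borel_measurable lborel" for n
      unfolding s_def using shift(1) intf by (auto simp: borel_measurable_integrable)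
    show "integrable lborel (\<lambda>x. M * indicator (cball 0 (r+1)) x)"
      by (intro integrable_mult_right integrable_real_indicator) (use emeasure_lborel_cball_finite in auto)
    show "AE x in lborel. (\<lambda>n. s n x) \<longlonglongrightarrow> partial i f x"
    proof (rule AE_I2)
      fix x
      have "((\<lambda>k. (f (x + k *\<^sub>R ?e) - f x) / k) \<longlongrightarrow> partial i f x) (at 0)"
        using derl[of x 0] by (simp add: DERIV_def)
      moreover have "filterlim h (at 0) sequentially"
      proof -
        have "h = (\<lambda>n. inverse (real (Suc n)))" by (simp add: h_def inverse_eq_divide fun_eq_iff)
        hence "h \<longlonglongrightarrow> 0" using LIMSEQ_inverse_real_of_nat by simp
        thus ?thesis unfolding filterlim_at using h(1) by (auto simp: less_imp_neq[symmetric] intro!: always_eventually)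
      qed
      ultimately show "(\<lambda>n. s n x) \<longlonglongrightarrow> partial i f x"
        unfolding s_def by (rule filterlim_compose)
    qed
  qed (use sb in auto)
  ultimately show ?thesis by (simp add: LIMSEQ_const_iff)
qed

lemma L2_spaceD:
  assumes "f \<in> L2_space D"
  shows "f \<in> borel_measurable (lebesgue_on D)" "integrable (lebesgue_on D) (\<lambda>x. (norm (f x))\<^sup>2)"
  using assms by (auto simp: L2_space_def)

lemma L2_space_integrable_norm_mult:
  assumes "f \<in> L2_space D" "g \<in> L2_space D"
  shows "integrable (lebesgue_on D) (\<lambda>x. norm (f x) * norm (g x))"
proof (rule Bochner_Integration.integrable_bound)
  note [measurable] = L2_spaceD(1)[OF assms(1)] L2_spaceD(1)[OF assms(2)]
  show "integrable (lebesgue_on D) (\<lambda>x. (norm (f x))\<^sup>2 + (norm (g x))\<^sup>2)"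
    using assms by (auto simp: L2_space_def)
  show "(\<lambda>x. norm (f x) * norm (g x)) \<in> borel_measurable (lebesgue_on D)" by measurable
  have "norm (norm (f x) * norm (g x)) \<le> norm ((norm (f x))\<^sup>2 + (norm (g x))\<^sup>2)" for x
  proof -
    have "0 \<le> norm (f x) * norm (g x)" by simp
    thus ?thesis using sum_squares_bound[of "norm (f x)" "norm (g x)"] unfolding real_norm_def by linarith
  qed
  thus "AE x in lebesgue_on D. norm (norm (f x) * norm (g x)) \<le> norm ((norm (f x))\<^sup>2 + (norm (g x))\<^sup>2)"
    by simp
qed

lemma L2_space_integrable_inner:
  assumes "f \<in> L2_space D" "g \<in> L2_space D"
  shows "integrable (lebesgue_on D) (\<lambda>x. f x \<bullet> g x)"
proof (rule Bochner_Integration.integrable_bound[OF L2_space_integrable_norm_mult[OF assms]])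
  note [measurable] = L2_spaceD(1)[OF assms(1)] L2_spaceD(1)[OF assms(2)]
  show "(\<lambda>x. f x \<bullet> g x) \<in> borel_measurable (lebesgue_on D)" by measurable
qed (simp add: Cauchy_Schwarz_ineq2)

lemma L2_space_lincomb:
  assumes "f \<in> L2_space D" "g \<in> L2_space D"
  shows "(\<lambda>x. f x + c *\<^sub>R g x) \<in> L2_space D"
proof -
  note [measurable] = L2_spaceD(1)[OF assms(1)] L2_spaceD(1)[OF assms(2)]
  have "(norm (f x + c *\<^sub>R g x))\<^sup>2 = (norm (f x))\<^sup>2 + 2 * c * (f x \<bullet> g x) + c\<^sup>2 * (norm (g x))\<^sup>2" for x
    by (simp only: power2_norm_eq_inner) (simp add: inner_add_left inner_add_right inner_commute power2_eq_square)
  thus ?thesis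
    using L2_spaceD(2)[OF assms(1)] L2_spaceD(2)[OF assms(2)] L2_space_integrable_inner[OF assms]
    by (simp add: L2_space_def)
qed

lemma L2_space_diff: "f \<in> L2_space D \<Longrightarrow> g \<in> L2_space D \<Longrightarrow> (\<lambda>x. f x - g x) \<in> L2_space D"
  using L2_space_lincomb[of f D g "-1"] by simp

lemma L2_norm_nonneg [simp]: "L2_norm D f \<ge> 0"
  by (simp add: L2_norm_def)

lemma L2_norm_power2: "(L2_norm D f)\<^sup>2 = (\<integral>x. (norm (f x))\<^sup>2 \<partial>lebesgue_on D)"
  by (simp add: L2_norm_def)

lemma L2_norm_commute: "L2_norm D (\<lambda>x. f x - g x) = L2_norm D (\<lambda>x. g x - f x)"
  by (simp add: L2_norm_def norm_minus_commute)

lemma L2_norm_lincomb_power2: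
  assumes "f \<in> L2_space D" "g \<in> L2_space D"
  shows "(L2_norm D (\<lambda>x. f x + c *\<^sub>R g x))\<^sup>2 =
    (L2_norm D f)\<^sup>2 + 2 * c * (\<integral>x. f x \<bullet> g x \<partial>lebesgue_on D) + c\<^sup>2 * (L2_norm D g)\<^sup>2"
proof -
  have "(norm (f x + c *\<^sub>R g x))\<^sup>2 = (norm (f x))\<^sup>2 + 2 * c * (f x \<bullet> g x) + c\<^sup>2 * (norm (g x))\<^sup>2" for x
    by (simp only: power2_norm_eq_inner) (simp add: inner_add_left inner_add_right inner_commute power2_eq_square)
  thus ?thesis
    using L2_spaceD(2)[OF assms(1)] L2_spaceD(2)[OF assms(2)] L2_space_integrable_inner[OF assms]
    by (simp add: L2_norm_power2)
qed

lemma L2_Cauchy_Schwarz: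
  assumes "f \<in> L2_space D" "g \<in> L2_space D"
  shows "\<bar>\<integral>x. f x \<bullet> g x \<partial>lebesgue_on D\<bar> \<le> L2_norm D f * L2_norm D g"
proof -
  define a b c where "a = L2_norm D f" and "b = L2_norm D g" and "c = (\<integral>x. f x \<bullet> g x \<partial>lebesgue_on D)"
  have ab: "a \<ge> 0" "b \<ge> 0" by (auto simp: a_def b_def)
  have pos: "a\<^sup>2 + 2 * t * c + t\<^sup>2 * b\<^sup>2 \<ge> 0" for t
    using L2_norm_lincomb_power2[OF assms, of t] unfolding a_def b_def c_def
    by (metis zero_le_power2)
  have "c\<^sup>2 \<le> (a * b)\<^sup>2"
  proof (cases "b = 0")
    case True
    have "c = 0"
    proof (rule ccontr)
      assume "c \<noteq> 0"
      \<comment> \<open>With \<open>b = 0\<close> the quadratic is linear in \<open>t\<close>, and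
        this \<open>t\<close> gives it the value -1.\<close>
      thus False using pos[of "- (a\<^sup>2 + 1) / (2 * c)"] True by (simp add: field_simps)
    qed
    thus ?thesis by simp
  next
    case False
    \<comment> \<open>The point \<open>t = - c / b^2\<close> minimises the quadratic.\<close>
    have "0 \<le> b\<^sup>2 * (a\<^sup>2 + 2 * (- c / b\<^sup>2) * c + (- c / b\<^sup>2)\<^sup>2 * b\<^sup>2)"
      by (intro mult_nonneg_nonneg pos) simp
    also have "\<dots> = (a * b)\<^sup>2 - c\<^sup>2"
      using False by (simp add: field_simps power2_eq_square)
    finally show ?thesis by simp
  qed
  hence "\<bar>c\<bar> \<le> \<bar>a * b\<bar>" by (simp add: abs_le_square_iff)
  thus ?thesis using ab by (simp add: a_def b_def c_def)
qed

lemma L2_norm_triangle: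
  assumes "f \<in> L2_space D" "g \<in> L2_space D"
  shows "L2_norm D (\<lambda>x. f x + g x) \<le> L2_norm D f + L2_norm D g"
proof (rule power2_le_imp_le)
  have "(L2_norm D (\<lambda>x. f x + g x))\<^sup>2 =
    (L2_norm D f)\<^sup>2 + 2 * (\<integral>x. f x \<bullet> g x \<partial>lebesgue_on D) + (L2_norm D g)\<^sup>2"
    using L2_norm_lincomb_power2[OF assms, of 1] by simp
  also have "\<dots> \<le> (L2_norm D f + L2_norm D g)\<^sup>2"
    using L2_Cauchy_Schwarz[OF assms] by (simp add: power2_sum)
  finally show "(L2_norm D (\<lambda>x. f x + g x))\<^sup>2 \<le> (L2_norm D f + L2_norm D g)\<^sup>2" .
qed simp

lemma L2_norm_diff_triangle:
  assumes "f \<in> L2_space D" "g \<in> L2_space D"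
  shows "L2_norm D (\<lambda>x. f x - g x) \<le> L2_norm D f + L2_norm D g"
proof -
  have "(\<lambda>x. - g x) \<in> L2_space D" "L2_norm D (\<lambda>x. - g x) = L2_norm D g"
    using assms(2) by (auto simp: L2_space_def L2_norm_def)
  thus ?thesis using L2_norm_triangle[OF assms(1), of "\<lambda>x. - g x"] by simp
qed

lemma L2_norm_eq_0_iff:
  assumes "f \<in> L2_space D"
  shows "L2_norm D f = 0 \<longleftrightarrow> (AE x in lebesgue_on D. f x = 0)"
  using integral_nonneg_eq_0_iff_AE[OF L2_spaceD(2)[OF assms]] by (simp add: L2_norm_def)

lemma L2_norm_cong_diff_0:
  assumes "f \<in> L2_space D" "g \<in> L2_space D" "L2_norm D (\<lambda>x. f x - g x) = 0"
  shows "L2_norm D f = L2_norm D g"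
  using L2_norm_triangle[OF assms(2) L2_space_diff[OF assms(1,2)]]
    L2_norm_diff_triangle[OF assms(1) L2_space_diff[OF assms(1,2)]] assms(3) by simp

lemma continuous_in_L2_space:
  fixes f :: "plane \<Rightarrow> 'b::euclidean_space"
  assumes cont: "continuous_on UNIV f" and D: "bounded D" "D \<in> sets lebesgue"
  shows "f \<in> L2_space D"
proof -
  have "bounded (f ` closure D)"
    using D(1) by (intro compact_imp_bounded compact_continuous_image continuous_on_subset[OF cont]) auto
  then obtain B where B: "\<And>x. x \<in> closure D \<Longrightarrow> norm (f x) \<le> B"
    unfolding bounded_iff by blast
  have meas: "f \<in> borel_measurable (lebesgue_on D)"
    using cont by (intro continuous_imp_measurable_on_sets_lebesgue) (auto intro: continuous_on_subset D)
  interpret finite_measure "lebesgue_on D"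
    using D by (intro finite_measure_lebesgue_on bounded_set_imp_lmeasurable)
  have "integrable (lebesgue_on D) (\<lambda>x. (norm (f x))\<^sup>2)"
  proof (rule integrable_const_bound[where B="B\<^sup>2"])
    show "AE x in lebesgue_on D. norm ((norm (f x))\<^sup>2) \<le> B\<^sup>2"
      using B closure_subset by (intro AE_I2) (auto intro!: power_mono simp: space_restrict_space)
  qed (use meas in measurable)
  with meas show ?thesis by (simp add: L2_space_def)
qed

text \<open>Links the two settings: translation invariance lives on the whole plane with
  \<open>lborel\<close>, whereas the norms are taken over \<open>D\<close>.\<close>

lemma integral_lebesgue_on_eq_lborel:
  fixes h :: "plane \<Rightarrow> real"
  assumes "continuous_on UNIV h" "\<And>x. x \<notin> D \<Longrightarrow> h x = 0" "D \<in> sets lebesgue"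
  shows "(\<integral>x. h x \<partial>lebesgue_on D) = (\<integral>x. h x \<partial>lborel)"
proof -
  have "(\<lambda>x. if x \<in> D then h x else 0) = h" using assms(2) by auto
  hence "(\<integral>x. h x \<partial>lebesgue_on D) = (\<integral>x. h x \<partial>lebesgue)"
    using Lebesgue_Measure.integral_restrict_UNIV[OF assms(3), of h] by simp
  thus ?thesis using assms(1) by (simp add: integral_completion borel_measurable_continuous_onI)
qed

lemma real_null_comparison:
  fixes a b :: "nat \<Rightarrow> real"
  assumes "\<And>n. \<bar>a n\<bar> \<le> b n" "b \<longlonglongrightarrow> 0"
  shows "a \<longlonglongrightarrow> 0"
  using assms(1) by (intro Lim_null_comparison[OF _ assms(2)] always_eventually) simp

lemma L2_inner_tendsto:
  assumes F: "\<And>n. F n \<in> L2_space D" and h: "h \<in> L2_space D" and f: "f \<in> L2_space D"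
    and lim: "(\<lambda>n. L2_norm D (\<lambda>x. F n x - h x)) \<longlonglongrightarrow> 0"
  shows "(\<lambda>n. \<integral>x. F n x \<bullet> f x \<partial>lebesgue_on D) \<longlonglongrightarrow> (\<integral>x. h x \<bullet> f x \<partial>lebesgue_on D)"
proof -
  have "\<bar>(\<integral>x. F n x \<bullet> f x \<partial>lebesgue_on D) - (\<integral>x. h x \<bullet> f x \<partial>lebesgue_on D)\<bar>
      \<le> L2_norm D (\<lambda>x. F n x - h x) * L2_norm D f" for n
  proof -
    have "(\<integral>x. F n x \<bullet> f x \<partial>lebesgue_on D) - (\<integral>x. h x \<bullet> f x \<partial>lebesgue_on D)
        = (\<integral>x. (F n x - h x) \<bullet> f x \<partial>lebesgue_on D)"
      using L2_space_integrable_inner[OF F f] L2_space_integrable_inner[OF h f]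
      by (simp add: inner_diff_left)
    thus ?thesis using L2_Cauchy_Schwarz[OF L2_space_diff[OF F h] f] by simp
  qed
  moreover have "(\<lambda>n. L2_norm D (\<lambda>x. F n x - h x) * L2_norm D f) \<longlonglongrightarrow> 0"
    using tendsto_mult_left_zero[OF lim] .
  ultimately have "(\<lambda>n. (\<integral>x. F n x \<bullet> f x \<partial>lebesgue_on D) - (\<integral>x. h x \<bullet> f x \<partial>lebesgue_on D)) \<longlonglongrightarrow> 0"
    by (rule real_null_comparison)
  thus ?thesis by (rule LIM_zero_cancel)
qed

lemma L2_norm_tendsto:
  assumes F: "\<And>n. F n \<in> L2_space D" and h: "h \<in> L2_space D"
    and lim: "(\<lambda>n. L2_norm D (\<lambda>x. F n x - h x)) \<longlonglongrightarrow> 0"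
  shows "(\<lambda>n. L2_norm D (F n)) \<longlonglongrightarrow> L2_norm D h"
proof -
  have "\<bar>L2_norm D (F n) - L2_norm D h\<bar> \<le> L2_norm D (\<lambda>x. F n x - h x)" for n
    using L2_norm_triangle[OF h L2_space_diff[OF F h], of n]
      L2_norm_diff_triangle[OF F L2_space_diff[OF F h], of n n] by simp
  hence "(\<lambda>n. L2_norm D (F n) - L2_norm D h) \<longlonglongrightarrow> 0"
    using lim by (rule real_null_comparison)
  thus ?thesis by (rule LIM_zero_cancel)
qed

section \<open>Calculus of smooth functions and test functions; integration by parts\<close>

lemma smooth_differentiable: "smooth f \<Longrightarrow> f differentiable_on UNIV"
  unfolding smooth_def by (metis foldr.simps(1) id_apply)

lemma smooth_continuous: "smooth f \<Longrightarrow> continuous_on UNIV f"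
  by (simp add: smooth_differentiable differentiable_imp_continuous_on)

lemma smooth_partial: "smooth f \<Longrightarrow> smooth (partial i f)"
proof -
  assume f: "smooth f"
  have "foldr partial is (partial i f) = foldr partial (is @ [i]) f" for "is" by simp
  thus ?thesis using f unfolding smooth_def by metis
qed

lemma has_derivative_frechet: "f differentiable_on UNIV \<Longrightarrow> (f has_derivative frechet_derivative f (at x)) (at x)"
  by (simp add: differentiable_on_def frechet_derivative_works)

lemma partial_diff:
  assumes "f differentiable_on UNIV" "g differentiable_on UNIV"
  shows "partial i (\<lambda>x. f x - g x) = (\<lambda>x. partial i f x - partial i g x)"
proof
  fix x
  show "partial i (\<lambda>x. f x - g x) x = partial i f x - partial i g x"
    using partial_eqI[OF has_derivative_diff[OF has_derivative_frechet[OF assms(1)] has_derivative_frechet[OF assms(2)]]]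
    by (simp add: partial_def)
qed

lemma partial_linear:
  assumes "f differentiable_on UNIV" "bounded_linear L"
  shows "partial i (\<lambda>x. L (f x)) = (\<lambda>x. L (partial i f x))"
proof
  fix x
  show "partial i (\<lambda>x. L (f x)) x = L (partial i f x)"
    using partial_eqI[OF bounded_linear.has_derivative[OF assms(2) has_derivative_frechet[OF assms(1)]]]
    by (simp add: partial_def)
qed

lemma smooth_foldr: "smooth f \<Longrightarrow> smooth (foldr partial is f)"
  by (induction "is") (auto intro: smooth_partial)

lemma smooth_diff:
  assumes "smooth f" "smooth g"
  shows "smooth (\<lambda>x. f x - g x)"
proof -
  have "foldr partial is (\<lambda>x. f x - g x) = (\<lambda>x. foldr partial is f x - foldr partial is g x)" for "is"
    by (induction "is") (use assms in \<open>auto simp: partial_diff smooth_differentiable smooth_foldr\<close>)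
  thus ?thesis using assms unfolding smooth_def by (auto intro: derivative_intros)
qed

lemma smooth_linear:
  assumes "smooth f" "bounded_linear L"
  shows "smooth (\<lambda>x. L (f x))"
proof -
  have "foldr partial is (\<lambda>x. L (f x)) = (\<lambda>x. L (foldr partial is f x))" for "is"
    by (induction "is") (use assms in \<open>auto simp: partial_linear smooth_differentiable smooth_foldr\<close>)
  moreover have "(\<lambda>x. L (foldr partial is f x)) differentiable_on UNIV" for "is"
    using bounded_linear.has_derivative[OF assms(2)] assms(1)
    unfolding smooth_def differentiable_on_def differentiable_def by blast
  ultimately show ?thesis unfolding smooth_def by auto
qed

lemma test_functions_smooth: "\<phi> \<in> test_functions D \<Longrightarrow> smooth \<phi>"
  by (simp add: test_functions_def)

lemma test_functions_outside: "\<phi> \<in> test_functions D \<Longrightarrow> x \<notin> D \<Longrightarrow> \<phi> x = 0"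
  using closure_subset[of "{x. \<phi> x \<noteq> 0}"] by (auto simp: test_functions_def)

text \<open>The support of \<open>f\<close> lies in the union of the two given supports. One
  statement thus covers differences and, with both test functions equal, linear images.\<close>

lemma test_functions_subset:
  assumes "\<phi> \<in> test_functions D" "\<psi> \<in> test_functions D" "smooth f"
    and "\<And>x. \<phi> x = 0 \<Longrightarrow> \<psi> x = 0 \<Longrightarrow> f x = 0"
  shows "f \<in> test_functions D"
proof -
  have "{x. f x \<noteq> 0} \<subseteq> {x. \<phi> x \<noteq> 0} \<union> {x. \<psi> x \<noteq> 0}" using assms(4) by blast
  hence sub: "closure {x. f x \<noteq> 0} \<subseteq> closure {x. \<phi> x \<noteq> 0} \<union> closure {x. \<psi> x \<noteq> 0}"
    by (metis closure_Un closure_mono)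
  have "compact (closure {x. \<phi> x \<noteq> 0} \<union> closure {x. \<psi> x \<noteq> 0})"
    using assms by (intro compact_Un) (auto simp: test_functions_def)
  from compact_imp_bounded[OF this] have "bounded (closure {x. f x \<noteq> 0})"
    using sub by (rule bounded_subset)
  hence "compact (closure {x. f x \<noteq> 0})"
    using compact_eq_bounded_closed by blast
  moreover have "closure {x. f x \<noteq> 0} \<subseteq> D"
    using sub assms(1,2) unfolding test_functions_def by blast
  ultimately show ?thesis using assms(3) by (simp add: test_functions_def)
qed

lemma test_functions_diff:
  assumes "\<phi> \<in> test_functions D" "\<psi> \<in> test_functions D"
  shows "(\<lambda>x. \<phi> x - \<psi> x) \<in> test_functions D"
  using assms by (intro test_functions_subset[OF assms] smooth_diff) (auto simp: test_functions_smooth)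

lemma test_functions_linear:
  assumes "\<phi> \<in> test_functions D" "bounded_linear L"
  shows "(\<lambda>x. L (\<phi> x)) \<in> test_functions D"
  by (rule test_functions_subset[OF assms(1) assms(1)
        smooth_linear[OF test_functions_smooth[OF assms(1)] assms(2)]])
    (simp add: linear_0[OF bounded_linear.linear[OF assms(2)]])

lemma grad_diff:
  assumes "smooth f" "smooth g"
  shows "grad (\<lambda>x. f x - g x) x = grad f x - grad g x"
  using assms by (simp add: grad_def partial_diff smooth_differentiable vec_eq_iff)

lemma continuous_on_grad: "smooth f \<Longrightarrow> continuous_on UNIV (grad f)"
  unfolding grad_def
  by (intro continuous_on_vec_lambda smooth_continuous smooth_partial)

text \<open>The product rule is applied to the inner product of \<open>\<phi>\<close> and
  \<open>\<eta>\<close>, which has bounded support and so a derivative of integral 0. Only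
  \<open>\<phi>\<close> carries the support condition, so \<open>\<eta>\<close> can later be a
  derivative of any smooth function or the product of a coordinate with a test function.\<close>

lemma integral_by_parts:
  fixes \<phi> \<eta> :: "plane \<Rightarrow> 'a::euclidean_space"
  assumes \<phi>: "\<phi> \<in> test_functions D"
    and \<eta>: "\<eta> differentiable_on UNIV" "continuous_on UNIV (partial i \<eta>)"
    and D: "bounded D" "D \<in> sets lebesgue"
  shows "(\<integral>x. partial i \<phi> x \<bullet> \<eta> x \<partial>lebesgue_on D) = - (\<integral>x. \<phi> x \<bullet> partial i \<eta> x \<partial>lebesgue_on D)"
proof -
  let ?f = "\<lambda>x. \<phi> x \<bullet> \<eta> x"
  have s: "smooth \<phi>" using \<phi> by (rule test_functions_smooth)
  have d\<phi>: "\<phi> differentiable_on UNIV" using s by (rule smooth_differentiable)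
  have cont: "continuous_on UNIV \<phi>" "continuous_on UNIV (partial i \<phi>)" "continuous_on UNIV \<eta>"
    using s smooth_continuous smooth_partial differentiable_imp_continuous_on \<eta> by blast+
  have der: "(?f has_derivative (\<lambda>h. \<phi> x \<bullet> frechet_derivative \<eta> (at x) h + frechet_derivative \<phi> (at x) h \<bullet> \<eta> x)) (at x)" for x
    by (rule has_derivative_inner[OF has_derivative_frechet[OF d\<phi>] has_derivative_frechet[OF \<eta>(1)]])
  have p: "partial i ?f = (\<lambda>x. \<phi> x \<bullet> partial i \<eta> x + partial i \<phi> x \<bullet> \<eta> x)"
    by (rule ext, subst partial_eqI[OF der]) (simp add: partial_def)
  have contp: "continuous_on UNIV (partial i ?f)"
    unfolding p by (intro continuous_intros cont \<eta>)
  have "(\<integral>x. partial i ?f x \<partial>lborel) = 0"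
  proof (rule integral_partial_eq_0[OF _ contp])
    show "?f differentiable_on UNIV"
      using der unfolding differentiable_on_def differentiable_def by auto
    have "{x. ?f x \<noteq> 0} \<subseteq> D" using test_functions_outside[OF \<phi>] by force
    thus "bounded {x. ?f x \<noteq> 0}" using D(1) bounded_subset by blast
  qed
  \<comment> \<open>Vanishing of \<open>?f\<close> off \<open>D\<close> does not by itself make the
    derivative vanish on the boundary of \<open>D\<close>. The argument uses the open complement of
    the closed support, which contains every point outside \<open>D\<close>.\<close>
  moreover have "partial i ?f x = 0" if "x \<notin> D" for x
  proof -
    have "closure {x. \<phi> x \<noteq> 0} \<subseteq> D" using \<phi> by (simp add: test_functions_def)
    hence "x \<in> - closure {x. \<phi> x \<noteq> 0}" using that by blast
    moreover have "?f y = 0" if "y \<in> - closure {x. \<phi> x \<noteq> 0}" for y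
      proof -
        have "\<phi> y = 0" using that closure_subset[of "{x. \<phi> x \<noteq> 0}"] by blast
        thus ?thesis by simp
      qed
    ultimately have "(?f has_derivative (\<lambda>_. 0)) (at x)"
      using has_derivative_transform_within_open[of "\<lambda>_. 0" "\<lambda>_. 0" x UNIV "- closure {x. \<phi> x \<noteq> 0}" ?f]
      by auto
    thus ?thesis by (simp add: partial_eqI)
  qed
  ultimately have "(\<integral>x. partial i ?f x \<partial>lebesgue_on D) = 0"
    using integral_lebesgue_on_eq_lborel[OF contp _ D(2)] by simp
  moreover have "integrable (lebesgue_on D) (\<lambda>x. \<phi> x \<bullet> partial i \<eta> x)"
       "integrable (lebesgue_on D) (\<lambda>x. partial i \<phi> x \<bullet> \<eta> x)"
    by (auto intro!: L2_space_integrable_inner continuous_in_L2_space cont \<eta> D)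
  ultimately show ?thesis unfolding p by simp
qed

subsection \<open>Poincare inequality and uniqueness of the weak gradient\<close>

lemma bounded_domain_imp:
  assumes "bounded_domain D"
  shows "bounded D" "D \<in> sets lebesgue"
  using assms by (auto simp: bounded_domain_def)

lemma smooth_in_L2_space:
  assumes "bounded_domain D" "smooth f"
  shows "f \<in> L2_space D"
  using continuous_in_L2_space smooth_continuous bounded_domain_imp assms by blast

lemma grad_in_L2_space:
  assumes "bounded_domain D" "smooth f"
  shows "grad f \<in> L2_space D"
  using continuous_in_L2_space continuous_on_grad bounded_domain_imp assms by blast

lemma L2_norm_mono:
  assumes f: "f \<in> L2_space D" and g: "g \<in> L2_space D"
    and le: "\<And>x. x \<in> D \<Longrightarrow> norm (f x) \<le> norm (g x)"
  shows "L2_norm D f \<le> L2_norm D g"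
proof -
  have "(\<integral>x. (norm (f x))\<^sup>2 \<partial>lebesgue_on D) \<le> (\<integral>x. (norm (g x))\<^sup>2 \<partial>lebesgue_on D)"
    by (rule integral_mono[OF L2_spaceD(2)[OF f] L2_spaceD(2)[OF g]])
      (use le in \<open>auto simp: space_restrict_space intro!: power_mono\<close>)
  thus ?thesis by (simp add: L2_norm_def)
qed

lemma L2_norm_scaleR: "L2_norm D (\<lambda>x. c *\<^sub>R f x) = \<bar>c\<bar> * L2_norm D f"
  by (simp add: L2_norm_def power_mult_distrib real_sqrt_mult)

text \<open>Removes every derivative from \<open>\<phi>\<close>, so that \<open>L^2\<close>
  convergence of the functions alone decides the limit of the Dirichlet form against a fixed smooth
  \<open>\<psi>\<close>.\<close>

lemma integral_grad_inner_grad: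
  fixes \<phi> \<psi> :: "plane \<Rightarrow> 'a::euclidean_space"
  assumes D: "bounded_domain D" and \<phi>: "\<phi> \<in> test_functions D" and \<psi>: "smooth \<psi>"
  shows "(\<integral>x. grad \<phi> x \<bullet> grad \<psi> x \<partial>lebesgue_on D) =
    - (\<integral>x. \<phi> x \<bullet> (\<Sum>i\<in>UNIV. partial i (partial i \<psi>) x) \<partial>lebesgue_on D)"
proof -
  have s: "smooth \<phi>" using \<phi> by (rule test_functions_smooth)
  have *: "(\<integral>x. partial i \<phi> x \<bullet> partial i \<psi> x \<partial>lebesgue_on D) =
      - (\<integral>x. \<phi> x \<bullet> partial i (partial i \<psi>) x \<partial>lebesgue_on D)" for i
    using integral_by_parts[OF \<phi> _ _ bounded_domain_imp[OF D]] \<psi>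
    by (simp add: smooth_partial smooth_differentiable smooth_continuous)
  have int: "integrable (lebesgue_on D) (\<lambda>x. partial i \<phi> x \<bullet> partial i \<psi> x)"
     "integrable (lebesgue_on D) (\<lambda>x. \<phi> x \<bullet> partial i (partial i \<psi>) x)" for i
    using s \<psi> by (auto intro!: L2_space_integrable_inner smooth_in_L2_space[OF D] smooth_partial)
  have "(\<integral>x. grad \<phi> x \<bullet> grad \<psi> x \<partial>lebesgue_on D) =
      (\<Sum>i\<in>UNIV. \<integral>x. partial i \<phi> x \<bullet> partial i \<psi> x \<partial>lebesgue_on D)"
    using int(1) by (simp add: inner_vec_def grad_def)
  also have "\<dots> = - (\<Sum>i\<in>UNIV. \<integral>x. \<phi> x \<bullet> partial i (partial i \<psi>) x \<partial>lebesgue_on D)"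
    by (simp add: * sum_negf)
  also have "\<dots> = - (\<integral>x. \<phi> x \<bullet> (\<Sum>i\<in>UNIV. partial i (partial i \<psi>) x) \<partial>lebesgue_on D)"
    using int(2) by (simp add: inner_sum_right)
  finally show ?thesis .
qed

section \<open>Limits of test functions together with their gradients\<close>

lemma W012_limitE:
  assumes "W012_limit D u g"
  obtains \<phi> :: "nat \<Rightarrow> plane \<Rightarrow> 'a::euclidean_space"
  where "u \<in> L2_space D" "g \<in> L2_space D" "\<And>n. \<phi> n \<in> test_functions D"
    "(\<lambda>n. L2_norm D (\<lambda>x. \<phi> n x - u x)) \<longlonglongrightarrow> 0"
    "(\<lambda>n. L2_norm D (\<lambda>x. grad (\<phi> n) x - g x)) \<longlonglongrightarrow> 0"
  using assms unfolding W012_limit_def by blast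

lemma W012_limit_test:
  assumes "bounded_domain D" "\<phi> \<in> test_functions D"
  shows "W012_limit D \<phi> (grad \<phi>)"
  unfolding W012_limit_def using assms test_functions_smooth[OF assms(2)]
  by (auto intro!: smooth_in_L2_space grad_in_L2_space exI[of _ "\<lambda>_. \<phi>"] simp: L2_norm_def)

lemma W012_limit_diff:
  assumes D: "bounded_domain D" and lim: "W012_limit D u g" "W012_limit D v h"
  shows "W012_limit D (\<lambda>x. u x - v x) (\<lambda>x. g x - h x)"
proof -
  obtain \<phi> where \<phi>: "u \<in> L2_space D" "g \<in> L2_space D" "\<And>n. \<phi> n \<in> test_functions D"
    "(\<lambda>n. L2_norm D (\<lambda>x. \<phi> n x - u x)) \<longlonglongrightarrow> 0"
    "(\<lambda>n. L2_norm D (\<lambda>x. grad (\<phi> n) x - g x)) \<longlonglongrightarrow> 0"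
    using lim(1) by (rule W012_limitE) blast
  obtain \<psi> where \<psi>: "v \<in> L2_space D" "h \<in> L2_space D" "\<And>n. \<psi> n \<in> test_functions D"
    "(\<lambda>n. L2_norm D (\<lambda>x. \<psi> n x - v x)) \<longlonglongrightarrow> 0"
    "(\<lambda>n. L2_norm D (\<lambda>x. grad (\<psi> n) x - h x)) \<longlonglongrightarrow> 0"
    using lim(2) by (rule W012_limitE) blast
  have L2: "\<phi> n \<in> L2_space D" "grad (\<phi> n) \<in> L2_space D" "\<psi> n \<in> L2_space D" "grad (\<psi> n) \<in> L2_space D" for n
    using \<phi>(3) \<psi>(3) smooth_in_L2_space[OF D] grad_in_L2_space[OF D] test_functions_smooth by blast+
  have reorder: "(a - b) - (c - d) = (a - c) - (b - d)" for a b c d :: "'z::ab_group_add"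
    by (simp add: algebra_simps)
  show ?thesis
    unfolding W012_limit_def
  proof (intro conjI exI[of _ "\<lambda>n x. \<phi> n x - \<psi> n x"] allI)
    show "(\<lambda>n. L2_norm D (\<lambda>x. \<phi> n x - \<psi> n x - (u x - v x))) \<longlonglongrightarrow> 0"
    proof (rule real_null_comparison)
      show "\<bar>L2_norm D (\<lambda>x. \<phi> n x - \<psi> n x - (u x - v x))\<bar>
          \<le> L2_norm D (\<lambda>x. \<phi> n x - u x) + L2_norm D (\<lambda>x. \<psi> n x - v x)" for n
        unfolding reorder
        using L2_norm_diff_triangle[OF L2_space_diff[OF L2(1) \<phi>(1)] L2_space_diff[OF L2(3) \<psi>(1)], of n n]
        by simp
    qed (use tendsto_add[OF \<phi>(4) \<psi>(4)] in simp)
    show "(\<lambda>n. L2_norm D (\<lambda>x. grad (\<lambda>x. \<phi> n x - \<psi> n x) x - (g x - h x))) \<longlonglongrightarrow> 0"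
    proof (rule real_null_comparison)
      show "\<bar>L2_norm D (\<lambda>x. grad (\<lambda>x. \<phi> n x - \<psi> n x) x - (g x - h x))\<bar>
          \<le> L2_norm D (\<lambda>x. grad (\<phi> n) x - g x) + L2_norm D (\<lambda>x. grad (\<psi> n) x - h x)" for n
        unfolding grad_diff[OF test_functions_smooth[OF \<phi>(3)] test_functions_smooth[OF \<psi>(3)]] reorder
        using L2_norm_diff_triangle[OF L2_space_diff[OF L2(2) \<phi>(2)] L2_space_diff[OF L2(4) \<psi>(2)], of n n]
        by simp
    qed (use tendsto_add[OF \<phi>(5) \<psi>(5)] in simp)
  qed (use \<phi> \<psi> in \<open>auto intro: L2_space_diff test_functions_diff\<close>)
qed

text \<open>Testing a limit of gradients against the gradient of a test function moves a derivative onto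
  the latter, so a gradient limit belonging to \<open>u = 0\<close> is orthogonal to the closure of the gradients,
  in particular to itself.\<close>

lemma W012_limit_0:
  assumes D: "bounded_domain D" and lim: "W012_limit D (\<lambda>_. 0 :: 'a::euclidean_space) h"
  shows "L2_norm D h = 0"
proof -
  obtain \<phi> where \<phi>: "h \<in> L2_space D" "\<And>n. \<phi> n \<in> test_functions D"
    "(\<lambda>n. L2_norm D (\<lambda>x. \<phi> n x - (0::'a))) \<longlonglongrightarrow> 0"
    "(\<lambda>n. L2_norm D (\<lambda>x. grad (\<phi> n) x - h x)) \<longlonglongrightarrow> 0"
    using lim by (rule W012_limitE) blast
  note s = test_functions_smooth[OF \<phi>(2)]
  note L2 = smooth_in_L2_space[OF D s] grad_in_L2_space[OF D s]
  have z: "(\<lambda>_. 0::'a) \<in> L2_space D" by (simp add: L2_space_def)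
  have orth: "(\<integral>x. h x \<bullet> grad (\<phi> m) x \<partial>lebesgue_on D) = 0" for m
  proof (rule LIMSEQ_unique)
    show "(\<lambda>n. \<integral>x. grad (\<phi> n) x \<bullet> grad (\<phi> m) x \<partial>lebesgue_on D) \<longlonglongrightarrow> (\<integral>x. h x \<bullet> grad (\<phi> m) x \<partial>lebesgue_on D)"
      by (rule L2_inner_tendsto[OF L2(2) \<phi>(1) L2(2) \<phi>(4)])
    have "(\<lambda>x. \<Sum>i\<in>UNIV. partial i (partial i (\<phi> m)) x) \<in> L2_space D"
      by (intro continuous_in_L2_space continuous_on_sum smooth_continuous smooth_partial s bounded_domain_imp D)
    from tendsto_minus[OF L2_inner_tendsto[OF L2(1) z this \<phi>(3)]]
    show "(\<lambda>n. \<integral>x. grad (\<phi> n) x \<bullet> grad (\<phi> m) x \<partial>lebesgue_on D) \<longlonglongrightarrow> 0"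
      by (simp add: integral_grad_inner_grad[OF D \<phi>(2) s])
  qed
  have "(\<lambda>m. \<integral>x. grad (\<phi> m) x \<bullet> h x \<partial>lebesgue_on D) \<longlonglongrightarrow> (\<integral>x. h x \<bullet> h x \<partial>lebesgue_on D)"
    by (rule L2_inner_tendsto[OF L2(2) \<phi>(1) \<phi>(1) \<phi>(4)])
  hence "(\<integral>x. h x \<bullet> h x \<partial>lebesgue_on D) = 0"
    using orth by (simp add: inner_commute LIMSEQ_const_iff)
  thus ?thesis by (simp add: L2_norm_def power2_norm_eq_inner)
qed

lemma W012_wgrad: "u \<in> W012 D \<Longrightarrow> W012_limit D u (wgrad D u)"
  unfolding W012_def wgrad_def using someI_ex[of "W012_limit D u"] by blast

text \<open>Frees the Dirichlet norm from the choice made in \<open>wgrad\<close>: two gradient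
  limits of the same \<open>u\<close> differ by a gradient limit of 0, which is null.\<close>

lemma dirichlet_norm_eq:
  assumes D: "bounded_domain D" and lim: "W012_limit D u g"
  shows "dirichlet_norm D u = L2_norm D g"
proof -
  have w: "W012_limit D u (wgrad D u)"
    using lim by (intro W012_wgrad) (auto simp: W012_def)
  have "L2_norm D (\<lambda>x. wgrad D u x - g x) = 0"
    using W012_limit_diff[OF D w lim] by (intro W012_limit_0[OF D]) simp
  thus ?thesis
    using lim w unfolding dirichlet_norm_def
    by (intro L2_norm_cong_diff_0) (auto simp: W012_limit_def)
qed

text \<open>Integrating by parts against \<open>x_1 \<phi>\<close>, whose first partial derivative
  is \<open>x_1\<close> times that of \<open>\<phi>\<close> plus \<open>\<phi>\<close> itself,
  expresses the squared norm of \<open>\<phi>\<close> as -2 times the integral of the inner product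
  of the first partial derivative with \<open>x_1 \<phi>\<close>. Cauchy--Schwarz with
  \<open>|x_1| \<le> R\<close> gives the constant \<open>2 * R\<close>.\<close>

lemma Poincare_test:
  fixes \<phi> :: "plane \<Rightarrow> 'a::euclidean_space"
  assumes D: "bounded_domain D" and R: "\<And>x. x \<in> D \<Longrightarrow> norm x \<le> R" and \<phi>: "\<phi> \<in> test_functions D"
  shows "L2_norm D \<phi> \<le> 2 * R * L2_norm D (grad \<phi>)"
proof -
  let ?\<eta> = "\<lambda>x::plane. (x $ 1) *\<^sub>R \<phi> x"
  note s = test_functions_smooth[OF \<phi>]
  have cont: "continuous_on UNIV \<phi>" "continuous_on UNIV (partial 1 \<phi>)"
    by (auto intro!: smooth_continuous s smooth_partial)
  have "((\<lambda>x::plane. x $ 1) has_derivative (\<lambda>x. x $ 1)) (at x)" for x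
    by (rule bounded_linear_imp_has_derivative[OF bounded_linear_vec_nth])
  from has_derivative_scaleR[OF this has_derivative_frechet[OF smooth_differentiable[OF s]]]
  have der: "(?\<eta> has_derivative (\<lambda>h. (x $ 1) *\<^sub>R frechet_derivative \<phi> (at x) h + (h $ 1) *\<^sub>R \<phi> x)) (at x)" for x .
  have p: "partial 1 ?\<eta> = (\<lambda>x. (x $ 1) *\<^sub>R partial 1 \<phi> x + \<phi> x)"
    by (rule ext, subst partial_eqI[OF der]) (simp add: partial_def)
  have contx: "continuous_on UNIV (\<lambda>x::plane. x $ 1)" by (intro continuous_intros)
  have \<eta>: "?\<eta> differentiable_on UNIV" "continuous_on UNIV (partial 1 ?\<eta>)" "continuous_on UNIV ?\<eta>"
    using der unfolding differentiable_on_def differentiable_def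
    by (auto simp: p intro!: continuous_on_add continuous_on_scaleR contx cont)
  have L2: "\<phi> \<in> L2_space D" "partial 1 \<phi> \<in> L2_space D" "?\<eta> \<in> L2_space D" "grad \<phi> \<in> L2_space D"
    by (auto intro!: continuous_in_L2_space cont \<eta> bounded_domain_imp D grad_in_L2_space s)
  have "(\<integral>x. partial 1 \<phi> x \<bullet> ?\<eta> x \<partial>lebesgue_on D) = - (\<integral>x. \<phi> x \<bullet> partial 1 ?\<eta> x \<partial>lebesgue_on D)"
    by (rule integral_by_parts[OF \<phi> \<eta>(1,2) bounded_domain_imp[OF D]])
  also have "(\<integral>x. \<phi> x \<bullet> partial 1 ?\<eta> x \<partial>lebesgue_on D) =
      (\<integral>x. partial 1 \<phi> x \<bullet> ?\<eta> x \<partial>lebesgue_on D) + (L2_norm D \<phi>)\<^sup>2"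
    using L2_space_integrable_inner[OF L2(2,3)] L2_space_integrable_inner[OF L2(1,1)]
    by (simp add: p inner_add_right inner_commute L2_norm_power2 power2_norm_eq_inner)
  finally have "(L2_norm D \<phi>)\<^sup>2 = - 2 * (\<integral>x. partial 1 \<phi> x \<bullet> ?\<eta> x \<partial>lebesgue_on D)" by simp
  also have "\<dots> \<le> 2 * (L2_norm D (partial 1 \<phi>) * L2_norm D ?\<eta>)"
    using L2_Cauchy_Schwarz[OF L2(2,3)] by linarith
  also have "\<dots> \<le> 2 * (L2_norm D (grad \<phi>) * (R * L2_norm D \<phi>))"
  proof -
    have "D \<noteq> {}" using D by (simp add: bounded_domain_def)
    then obtain x0 where "x0 \<in> D" by blast
    hence R0: "R \<ge> 0" using R norm_ge_zero order_trans by blast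
    have "L2_norm D (partial 1 \<phi>) \<le> L2_norm D (grad \<phi>)"
      by (intro L2_norm_mono L2) (metis Finite_Cartesian_Product.norm_nth_le grad_def vec_lambda_beta)
    moreover have "L2_norm D ?\<eta> \<le> L2_norm D (\<lambda>x. R *\<^sub>R \<phi> x)"
    proof (rule L2_norm_mono)
      show "(\<lambda>x. R *\<^sub>R \<phi> x) \<in> L2_space D"
        by (intro continuous_in_L2_space continuous_intros cont bounded_domain_imp D)
      show "norm ((x $ 1) *\<^sub>R \<phi> x) \<le> norm (R *\<^sub>R \<phi> x)" if "x \<in> D" for x
        using order_trans[OF component_le_norm_cart R[OF that]] R0 by (simp add: mult_right_mono)
    qed (rule L2)
    ultimately show ?thesis using R0
      by (intro mult_left_mono mult_mono) (auto simp: L2_norm_scaleR)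
  qed
  finally have "L2_norm D \<phi> * L2_norm D \<phi> \<le> L2_norm D \<phi> * (2 * R * L2_norm D (grad \<phi>))"
    by (simp add: power2_eq_square algebra_simps)
  moreover have "0 \<le> 2 * R * L2_norm D (grad \<phi>)"
  proof -
    obtain x0 where "x0 \<in> D" using D by (auto simp: bounded_domain_def)
    hence "R \<ge> 0" using R norm_ge_zero order_trans by blast
    thus ?thesis by simp
  qed
  ultimately show ?thesis
    by (cases "L2_norm D \<phi> = 0") (auto simp: less_le)
qed

text \<open>The Poincare inequality survives the passage to the limit. Its use is the
  contrapositive: a nontrivial function has positive Dirichlet norm, so dividing by that norm is
  legitimate.\<close>

lemma W012_limit_gradient_0:
  fixes u :: "plane \<Rightarrow> 'a::euclidean_space"
  assumes D: "bounded_domain D" and lim: "W012_limit D u g" and 0: "L2_norm D g = 0"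
  shows "AE x in lebesgue_on D. u x = 0"
proof -
  obtain R where R: "\<And>x. x \<in> D \<Longrightarrow> norm x \<le> R"
    using bounded_domain_imp(1)[OF D] unfolding bounded_iff by blast
  obtain \<phi> where \<phi>: "u \<in> L2_space D" "g \<in> L2_space D" "\<And>n. \<phi> n \<in> test_functions D"
    "(\<lambda>n. L2_norm D (\<lambda>x. \<phi> n x - u x)) \<longlonglongrightarrow> 0"
    "(\<lambda>n. L2_norm D (\<lambda>x. grad (\<phi> n) x - g x)) \<longlonglongrightarrow> 0"
    using lim by (rule W012_limitE) blast
  note s = test_functions_smooth[OF \<phi>(3)]
  have "(\<lambda>n. L2_norm D (\<phi> n)) \<longlonglongrightarrow> L2_norm D u"
    by (rule L2_norm_tendsto[OF smooth_in_L2_space[OF D s] \<phi>(1) \<phi>(4)])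
  moreover have "(\<lambda>n. 2 * R * L2_norm D (grad (\<phi> n))) \<longlonglongrightarrow> 2 * R * L2_norm D g"
    by (intro tendsto_mult_left L2_norm_tendsto[OF grad_in_L2_space[OF D s] \<phi>(2) \<phi>(5)])
  ultimately have "L2_norm D u \<le> 2 * R * L2_norm D g"
    by (rule LIMSEQ_le) (use Poincare_test[OF D R \<phi>(3)] in blast)
  hence "L2_norm D u = 0" using 0 L2_norm_nonneg[of D u] by simp
  thus ?thesis using \<phi>(1) by (simp add: L2_norm_eq_0_iff)
qed

subsection \<open>Young and Moser--Trudinger inequalities\<close>

lemma young_N_nonneg: "young_N y \<ge> 0"
proof (cases "y \<ge> 1")
  case True
  have "ln (1 / y) \<le> 1 / y - 1" using True by (intro ln_le_minus_one) auto
  hence "y * (- ln y) \<le> y * (1 / y - 1)" using True by (intro mult_left_mono) (auto simp: ln_div)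
  thus ?thesis using True by (simp add: young_N_def algebra_simps)
qed (simp add: young_N_def)

text \<open>For \<open>a \<ge> 1\<close> this is \<open>1 + s \<le> exp s\<close> at
  \<open>s = b - ln a\<close>, multiplied by \<open>a\<close>. For \<open>a < 1\<close>, where
  \<open>young_N\<close> vanishes, \<open>b \<ge> 0\<close> gives
  \<open>a * b \<le> b \<le> exp b - 1\<close>.\<close>

lemma young_N_inequality:
  assumes "b \<ge> 0"
  shows "a * b \<le> young_N a + (exp b - 1)"
proof (cases "a \<ge> 1")
  case True
  have "1 + (b - ln a) \<le> exp (b - ln a)" by (rule exp_ge_add_one_self)
  hence "a * (1 + (b - ln a)) \<le> a * exp (b - ln a)" using True by (intro mult_left_mono) auto
  also have "\<dots> = exp b" using True by (simp add: exp_diff)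
  finally show ?thesis using True by (simp add: young_N_def algebra_simps)
next
  case False
  have "a * b \<le> 1 * b" using False assms by (intro mult_right_mono) auto
  also have "\<dots> \<le> exp b - 1" using exp_ge_add_one_self[of b] by linarith
  finally show ?thesis using False by (simp add: young_N_def)
qed

text \<open>The equality case \<open>a = exp b\<close> of Young's inequality.\<close>

lemma young_N_exp: "b \<ge> 0 \<Longrightarrow> young_N (exp b) = b * exp b - exp b + 1"
  by (simp add: young_N_def)

lemma measurable_young_N [measurable]: "young_N \<in> borel_measurable borel"
  unfolding young_N_def by measurable

text \<open>Writing \<open>ln (v / t) = ln v - ln t\<close> and using
  \<open>a + b \<le> (1 + a) * (1 + b)\<close> separates the scale \<open>t\<close> from
  \<open>v\<close>. The right factor is exactly the integrand that defines \<open>LlogL\<close>, so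
  all scales are controlled at once.\<close>

lemma young_N_scale_le:
  assumes "v \<ge> 0" "t > 0"
  shows "young_N (v / t) \<le> (1 + \<bar>ln t\<bar>) / t * (v * (1 + max 0 (ln v)))"
proof (cases "v / t \<ge> 1")
  case True
  hence v: "v > 0" using assms by (cases "v = 0") auto
  have "ln v - ln t \<le> max 0 (ln v) + \<bar>ln t\<bar>" by linarith
  also have "\<dots> \<le> (1 + \<bar>ln t\<bar>) * (1 + max 0 (ln v))"
  proof -
    have "a + b \<le> (1 + b) * (1 + a)" if "a \<ge> 0" "b \<ge> 0" for a b :: real
      using mult_nonneg_nonneg[OF that] by (simp add: algebra_simps)
    thus ?thesis by simp
  qed
  finally have "v / t * ln (v / t) \<le> v / t * ((1 + \<bar>ln t\<bar>) * (1 + max 0 (ln v)))"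
    using v assms by (intro mult_left_mono) (auto simp: ln_div)
  moreover have "young_N (v / t) \<le> v / t * ln (v / t)" using True by (simp add: young_N_def)
  ultimately show ?thesis by (simp add: mult.left_commute)
next
  case False
  thus ?thesis using assms by (simp add: young_N_def)
qed

text \<open>The Bochner integral of a non-integrable function is 0 by convention. Integrability at
  every scale ensures that each term of the infimum in \<open>LlogL_norm\<close> has its intended
  value.\<close>

lemma LlogL_integrable:
  assumes V: "V \<in> LlogL D"
  shows "integrable (lebesgue_on D) V"
    and "t > 0 \<Longrightarrow> integrable (lebesgue_on D) (\<lambda>x. young_N (\<bar>V x\<bar> / t))"
proof -
  let ?G = "\<lambda>x. \<bar>V x\<bar> * (1 + max 0 (ln \<bar>V x\<bar>))"
  have [measurable]: "V \<in> borel_measurable (lebesgue_on D)" and G: "integrable (lebesgue_on D) ?G"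
    using V by (auto simp: LlogL_def)
  show "integrable (lebesgue_on D) V"
    by (rule Bochner_Integration.integrable_bound[OF G])
      (auto intro!: AE_I2 simp: abs_mult mult_le_cancel_left1)
  assume t: "t > 0"
  show "integrable (lebesgue_on D) (\<lambda>x. young_N (\<bar>V x\<bar> / t))"
  proof (rule Bochner_Integration.integrable_bound)
    show "integrable (lebesgue_on D) (\<lambda>x. (1 + \<bar>ln t\<bar>) / t * ?G x)" using G by simp
    show "AE x in lebesgue_on D. norm (young_N (\<bar>V x\<bar> / t)) \<le> norm ((1 + \<bar>ln t\<bar>) / t * ?G x)"
    proof (rule AE_I2)
      fix x
      show "norm (young_N (\<bar>V x\<bar> / t)) \<le> norm ((1 + \<bar>ln t\<bar>) / t * ?G x)"
        using young_N_scale_le[of "\<bar>V x\<bar>" t] young_N_nonneg[of "\<bar>V x\<bar> / t"] t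
        unfolding real_norm_def by linarith
    qed
  qed measurable
qed

lemma pos_part_LlogL:
  assumes "V \<in> LlogL D"
  shows "pos_part V \<in> LlogL D"
proof -
  let ?G = "\<lambda>x. \<bar>V x\<bar> * (1 + max 0 (ln \<bar>V x\<bar>))"
  have [measurable]: "V \<in> borel_measurable (lebesgue_on D)" and G: "integrable (lebesgue_on D) ?G"
    using assms by (auto simp: LlogL_def)
  have m [measurable]: "pos_part V \<in> borel_measurable (lebesgue_on D)"
    unfolding pos_part_def[abs_def] by measurable
  have "integrable (lebesgue_on D) (\<lambda>x. \<bar>pos_part V x\<bar> * (1 + max 0 (ln \<bar>pos_part V x\<bar>)))"
  proof (rule Bochner_Integration.integrable_bound[OF G])
    show "AE x in lebesgue_on D. norm (\<bar>pos_part V x\<bar> * (1 + max 0 (ln \<bar>pos_part V x\<bar>))) \<le> norm (?G x)"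
    proof (rule AE_I2)
      fix x
      show "norm (\<bar>pos_part V x\<bar> * (1 + max 0 (ln \<bar>pos_part V x\<bar>))) \<le> norm (?G x)"
        by (cases "V x \<le> 0") (simp_all add: pos_part_def max_absorb1 max_absorb2)
    qed
  qed measurable
  with m show ?thesis by (simp add: LlogL_def)
qed

section \<open>Consequences of the Moser--Trudinger inequality\<close>

text \<open>Replacing the gradient norm by a larger \<open>k\<close> only decreases the exponent.
  Allowing slack in \<open>k\<close> also admits functions vanishing almost everywhere, for which
  the normalised quotient has no meaning; for them the integrand is 0.\<close>

lemma MT_scaled:
  fixes w :: "plane \<Rightarrow> 'a::euclidean_space"
  assumes D: "bounded_domain D"
    and MT: "\<And>w::plane \<Rightarrow> 'a. w \<in> W012 D \<Longrightarrow> nontrivial D w \<Longrightarrow> MT_integral D w \<le> ennreal A"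
    and A: "A \<ge> 0"
    and lim: "W012_limit D w g" and k: "L2_norm D g \<le> k" "k > 0"
  shows "integrable (lebesgue_on D) (\<lambda>x. exp (4 * pi * (norm (w x) / k)\<^sup>2) - 1)"
    and "(\<integral>x. exp (4 * pi * (norm (w x) / k)\<^sup>2) - 1 \<partial>lebesgue_on D) \<le> A"
proof -
  let ?E = "\<lambda>x. exp (4 * pi * (norm (w x) / k)\<^sup>2) - 1"
  have w: "w \<in> W012 D" using lim by (auto simp: W012_def)
  have [measurable]: "w \<in> borel_measurable (lebesgue_on D)"
    using lim by (auto simp: W012_limit_def L2_space_def)
  have nn: "(\<integral>\<^sup>+x. ennreal (?E x) \<partial>lebesgue_on D) \<le> ennreal A"
  proof (cases "nontrivial D w")
    case True
    have d: "dirichlet_norm D w = L2_norm D g" by (rule dirichlet_norm_eq[OF D lim])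
    have "L2_norm D g \<noteq> 0"
      using True W012_limit_gradient_0[OF D lim] by (auto simp: nontrivial_def)
    hence "L2_norm D g > 0" by (simp add: less_le)
    hence "?E x \<le> exp (4 * pi * (norm (w x) / dirichlet_norm D w)\<^sup>2) - 1" for x
      unfolding d using k by (auto intro!: mult_left_mono power_mono divide_left_mono)
    hence "(\<integral>\<^sup>+x. ennreal (?E x) \<partial>lebesgue_on D) \<le> MT_integral D w"
      unfolding MT_integral_def by (intro nn_integral_mono ennreal_leI)
    also have "\<dots> \<le> ennreal A" by (rule MT[OF w True])
    finally show ?thesis .
  next
    case False
    hence "AE x in lebesgue_on D. w x = 0" by (simp add: nontrivial_def)
    hence "(\<integral>\<^sup>+x. ennreal (?E x) \<partial>lebesgue_on D) = (\<integral>\<^sup>+x. 0 \<partial>lebesgue_on D)"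
      by (intro nn_integral_cong_AE) auto
    thus ?thesis by simp
  qed
  have pos: "?E x \<ge> 0" for x by simp
  show int: "integrable (lebesgue_on D) ?E"
  proof (rule integrableI_nonneg)
    show "(\<integral>\<^sup>+x. ennreal (?E x) \<partial>lebesgue_on D) < \<infinity>"
      using nn by (rule le_less_trans) simp
  qed (simp_all)
  have "ennreal (\<integral>x. ?E x \<partial>lebesgue_on D) \<le> ennreal A"
    using nn nn_integral_eq_integral[OF int AE_I2[OF pos]] by simp
  thus "(\<integral>x. ?E x \<partial>lebesgue_on D) \<le> A" using A by (simp add: ennreal_le_iff)
qed

text \<open>The second claim is what later makes \<open>C\<^sub>2 * measure lebesgue D\<close>
  positive: the Moser--Trudinger inequality places it above a positive quantity as soon as some
  nontrivial function exists.\<close>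

lemma MT_integral_pos:
  fixes w :: "plane \<Rightarrow> 'a::euclidean_space"
  assumes D: "bounded_domain D" and w: "w \<in> W012 D" and nt: "nontrivial D w"
  shows "dirichlet_norm D w > 0" "MT_integral D w > 0"
proof -
  note lim = W012_wgrad[OF w]
  have [measurable]: "w \<in> borel_measurable (lebesgue_on D)"
    using lim by (auto simp: W012_limit_def L2_space_def)
  have "dirichlet_norm D w \<noteq> 0"
    using nt W012_limit_gradient_0[OF D lim] by (auto simp: nontrivial_def dirichlet_norm_def)
  thus d: "dirichlet_norm D w > 0" by (simp add: dirichlet_norm_def less_le)
  have "MT_integral D w \<noteq> 0"
  proof
    assume "MT_integral D w = 0"
    hence "AE x in lebesgue_on D. ennreal (exp (4 * pi * (norm (w x) / dirichlet_norm D w)\<^sup>2) - 1) = 0"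
      unfolding MT_integral_def by (subst (asm) nn_integral_0_iff_AE) auto
    hence "AE x in lebesgue_on D. w x = 0"
    proof eventually_elim
      case (elim x)
      hence "4 * pi * (norm (w x) / dirichlet_norm D w)\<^sup>2 \<le> 0" by (simp add: ennreal_eq_0_iff)
      hence "(norm (w x) / dirichlet_norm D w)\<^sup>2 \<le> 0" using pi_gt_zero by (simp add: mult_le_0_iff)
      thus ?case using d by simp
    qed
    thus False using nt by (simp add: nontrivial_def)
  qed
  thus "MT_integral D w > 0" by (simp add: zero_less_iff_neq_zero)
qed

text \<open>Trudinger's splitting: \<open>u\<close> is the sum of a bounded test function and a remainder whose
  Dirichlet norm is so small that the Moser--Trudinger inequality covers the exponent \<open>2p\<close>.\<close>

lemma exp_square_integrable:
  fixes u :: "plane \<Rightarrow> 'a::euclidean_space"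
  assumes D: "bounded_domain D"
    and MT: "\<And>w::plane \<Rightarrow> 'a. w \<in> W012 D \<Longrightarrow> nontrivial D w \<Longrightarrow> MT_integral D w \<le> ennreal A"
    and A: "A \<ge> 0" and u: "u \<in> W012 D" and p: "p > 0"
  shows "integrable (lebesgue_on D) (\<lambda>x. exp (p * (norm (u x))\<^sup>2))"
proof -
  \<comment> \<open>Chosen so that \<open>4 * pi / k^2 = 2 * p\<close>. The doubled exponent pays
    for \<open>(r + B)^2 \<le> 2 * r^2 + 2 * B^2\<close>, where \<open>B\<close> bounds the test
    function on \<open>D\<close> and \<open>r\<close> is the norm of the remainder.\<close>
  define k where "k = sqrt (2 * pi / p)"
  have k: "k > 0" "k\<^sup>2 = 2 * pi / p" using p by (auto simp: k_def)
  note lim = W012_wgrad[OF u]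
  obtain \<phi> where \<phi>: "u \<in> L2_space D" "wgrad D u \<in> L2_space D" "\<And>n. \<phi> n \<in> test_functions D"
    "(\<lambda>n. L2_norm D (\<lambda>x. grad (\<phi> n) x - wgrad D u x)) \<longlonglongrightarrow> 0"
    using lim by (rule W012_limitE) blast
  have [measurable]: "u \<in> borel_measurable (lebesgue_on D)" using \<phi>(1) by (rule L2_spaceD)
  have "\<forall>\<^sub>F n in sequentially. L2_norm D (\<lambda>x. grad (\<phi> n) x - wgrad D u x) < k"
    using \<phi>(4) k(1) by (rule order_tendstoD)
  then obtain n where n: "L2_norm D (\<lambda>x. grad (\<phi> n) x - wgrad D u x) < k"
    using eventually_happens'[OF sequentially_bot] by blast
  define w where "w x = u x - \<phi> n x" for x
  have "W012_limit D w (\<lambda>x. wgrad D u x - grad (\<phi> n) x)"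
    unfolding w_def by (rule W012_limit_diff[OF D lim W012_limit_test[OF D \<phi>(3)]])
  moreover have "L2_norm D (\<lambda>x. wgrad D u x - grad (\<phi> n) x) \<le> k"
    using n L2_norm_commute[of D "wgrad D u" "grad (\<phi> n)"] by simp
  ultimately have int: "integrable (lebesgue_on D) (\<lambda>x. exp (4 * pi * (norm (w x) / k)\<^sup>2) - 1)"
    using MT_scaled(1)[OF D MT A] k(1) by blast
  interpret finite_measure "lebesgue_on D"
    using bounded_domain_imp[OF D] by (intro finite_measure_lebesgue_on bounded_set_imp_lmeasurable)
  have intE: "integrable (lebesgue_on D) (\<lambda>x. exp (2 * p * (norm (w x))\<^sup>2))"
    using Bochner_Integration.integrable_add[OF int integrable_const[of 1]] p k(2)
    by (simp add: power_divide field_simps)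
  have "bounded (\<phi> n ` closure D)"
    using bounded_domain_imp(1)[OF D] test_functions_smooth[OF \<phi>(3)]
    by (intro compact_imp_bounded compact_continuous_image continuous_on_subset[OF smooth_continuous]) auto
  then obtain B where B: "\<And>x. x \<in> closure D \<Longrightarrow> norm (\<phi> n x) \<le> B"
    unfolding bounded_iff by blast
  show ?thesis
  proof (rule Bochner_Integration.integrable_bound)
    show "integrable (lebesgue_on D) (\<lambda>x. exp (2 * p * B\<^sup>2) * exp (2 * p * (norm (w x))\<^sup>2))"
      using intE by simp
    show "AE x in lebesgue_on D. norm (exp (p * (norm (u x))\<^sup>2)) \<le>
        norm (exp (2 * p * B\<^sup>2) * exp (2 * p * (norm (w x))\<^sup>2))"
    proof (rule AE_I2)
      fix x assume "x \<in> space (lebesgue_on D)"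
      hence x: "norm (\<phi> n x) \<le> B" using B closure_subset by (auto simp: space_restrict_space)
      have "norm (u x) \<le> norm (w x) + norm (\<phi> n x)"
        unfolding w_def using norm_triangle_ineq[of "u x - \<phi> n x" "\<phi> n x"] by simp
      hence "norm (u x) \<le> norm (w x) + B" using x by simp
      hence "(norm (u x))\<^sup>2 \<le> (norm (w x) + B)\<^sup>2" by (intro power_mono) auto
      also have "\<dots> \<le> 2 * B\<^sup>2 + 2 * (norm (w x))\<^sup>2"
        using sum_squares_bound[of "norm (w x)" B] by (simp add: power2_sum)
      finally have "p * (norm (u x))\<^sup>2 \<le> p * (2 * B\<^sup>2 + 2 * (norm (w x))\<^sup>2)"
        using p by (intro mult_left_mono) auto
      thus "norm (exp (p * (norm (u x))\<^sup>2)) \<le> norm (exp (2 * p * B\<^sup>2) * exp (2 * p * (norm (w x))\<^sup>2))"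
        by (simp add: exp_add[symmetric] algebra_simps)
    qed
  qed measurable
qed

text \<open>The pointwise Young inequality, integrated. What matters is the factor
  \<open>k^2\<close>: for fixed \<open>f\<close> and \<open>t\<close> the weighted integral tends to
  0 with the Dirichlet norm of \<open>w\<close>, although \<open>f\<close> need not be
  bounded.\<close>

lemma integral_weighted_square:
  fixes w :: "plane \<Rightarrow> 'a::euclidean_space"
  assumes D: "bounded_domain D"
    and MT: "\<And>w::plane \<Rightarrow> 'a. w \<in> W012 D \<Longrightarrow> nontrivial D w \<Longrightarrow> MT_integral D w \<le> ennreal A"
    and A: "A \<ge> 0"
    and lim: "W012_limit D w g" and k: "L2_norm D g \<le> k" "k > 0"
    and f [measurable]: "f \<in> borel_measurable (lebesgue_on D)" and f0: "\<And>x. f x \<ge> 0" and t: "t > 0"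
    and N: "integrable (lebesgue_on D) (\<lambda>x. young_N (f x / t))"
  shows "integrable (lebesgue_on D) (\<lambda>x. f x * (norm (w x))\<^sup>2)"
    and "(\<integral>x. f x * (norm (w x))\<^sup>2 \<partial>lebesgue_on D) \<le>
      k\<^sup>2 * (t / (4 * pi) * ((\<integral>x. young_N (f x / t) \<partial>lebesgue_on D) + A))"
proof -
  let ?E = "\<lambda>x. exp (4 * pi * (norm (w x) / k)\<^sup>2) - 1"
  let ?c = "t * k\<^sup>2 / (4 * pi)"
  have [measurable]: "w \<in> borel_measurable (lebesgue_on D)"
    using lim by (auto simp: W012_limit_def L2_space_def)
  note E = MT_scaled[OF D MT A lim k]
  have c: "?c > 0" using t k by simp
  have le: "f x * (norm (w x))\<^sup>2 \<le> ?c * (young_N (f x / t) + ?E x)" for x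
  proof -
    have "f x * (norm (w x))\<^sup>2 = ?c * (f x / t * (4 * pi * (norm (w x) / k)\<^sup>2))"
      using t k by (simp add: power_divide)
    also have "\<dots> \<le> ?c * (young_N (f x / t) + ?E x)"
      by (rule mult_left_mono[OF young_N_inequality]) (use c in auto)
    finally show ?thesis .
  qed
  have int: "integrable (lebesgue_on D) (\<lambda>x. ?c * (young_N (f x / t) + ?E x))"
    using N E(1) by (intro integrable_mult_right Bochner_Integration.integrable_add) auto
  show i: "integrable (lebesgue_on D) (\<lambda>x. f x * (norm (w x))\<^sup>2)"
  proof (rule Bochner_Integration.integrable_bound[OF int])
    show "AE x in lebesgue_on D. norm (f x * (norm (w x))\<^sup>2) \<le> norm (?c * (young_N (f x / t) + ?E x))"
    proof (rule AE_I2)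
      fix x
      have "f x * (norm (w x))\<^sup>2 \<ge> 0" using f0 by simp
      thus "norm (f x * (norm (w x))\<^sup>2) \<le> norm (?c * (young_N (f x / t) + ?E x))"
        using le[of x] unfolding real_norm_def by linarith
    qed
  qed measurable
  have "(\<integral>x. f x * (norm (w x))\<^sup>2 \<partial>lebesgue_on D) \<le> (\<integral>x. ?c * (young_N (f x / t) + ?E x) \<partial>lebesgue_on D)"
    by (rule integral_mono[OF i int le])
  also have "\<dots> = ?c * ((\<integral>x. young_N (f x / t) \<partial>lebesgue_on D) + (\<integral>x. ?E x \<partial>lebesgue_on D))"
    using Bochner_Integration.integral_add[OF N E(1)] by simp
  also have "\<dots> \<le> ?c * ((\<integral>x. young_N (f x / t) \<partial>lebesgue_on D) + A)"
    using E(2) c by (intro mult_left_mono add_left_mono) auto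
  finally show "(\<integral>x. f x * (norm (w x))\<^sup>2 \<partial>lebesgue_on D) \<le>
      k\<^sup>2 * (t / (4 * pi) * ((\<integral>x. young_N (f x / t) \<partial>lebesgue_on D) + A))"
    by (simp add: mult.assoc mult.left_commute)
qed

subsection \<open>Energy identity and bounds for the norm\<close>

text \<open>The pairing \<open>(a, b) \<mapsto> Re (a b)\<close> is nondegenerate; in the complex case \<open>L\<close> is conjugation.\<close>

lemma ex_linear_transpose_mult:
  "\<exists>L :: 'a \<Rightarrow> 'a::{real_normed_field, euclidean_space}.
     bounded_linear L \<and> (\<forall>a b. (a * L b) \<bullet> 1 = a \<bullet> b)"
proof -
  \<comment> \<open>The vector representing the functional that sends \<open>a\<close> to
    \<open>(a * b) \<bullet> 1\<close>. The map \<open>c\<close> is injective because nonzero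
    scalars are invertible, hence bijective in finite dimension, and \<open>L\<close> is its
    inverse.\<close>
  define c :: "'a \<Rightarrow> 'a" where "c b = (\<Sum>e\<in>Basis. ((e * b) \<bullet> 1) *\<^sub>R e)" for b
  have lin: "linear c"
    unfolding c_def
    by (auto intro!: linearI simp: distrib_left inner_add_left scaleR_add_left sum.distrib scaleR_right.sum)
  have c: "a \<bullet> c b = (a * b) \<bullet> 1" for a b
  proof -
    have "(a * b) \<bullet> 1 = ((\<Sum>e\<in>Basis. (a \<bullet> e) *\<^sub>R e) * b) \<bullet> 1"
      by (simp add: euclidean_representation)
    also have "\<dots> = (\<Sum>e\<in>Basis. (a \<bullet> e) * ((e * b) \<bullet> 1))"
      by (simp add: sum_distrib_right inner_sum_left)
    finally show ?thesis by (simp add: c_def inner_sum_right mult.commute)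
  qed
  have "inj c"
  proof (rule injI)
    fix x y assume "c x = c y"
    hence *: "(a * (x - y)) \<bullet> 1 = 0" for a
      using c[of a x] c[of a y] by (simp add: right_diff_distrib inner_diff_left)
    show "x = y"
    proof (rule ccontr)
      assume "x \<noteq> y"
      thus False using *[of "inverse (x - y)"] by simp
    qed
  qed
  with lin obtain L where L: "linear L" "\<And>x. c (L x) = x"
    using linear_injective_isomorphism by blast
  have "(a * L b) \<bullet> 1 = a \<bullet> b" for a b using c[of a "L b"] L(2) by simp
  thus ?thesis using L(1) linear_conv_bounded_linear by blast
qed

text \<open>Interpolates between the weights 1 and \<open>|u|^2\<close> by
  \<open>r \<le> 1 + r^2\<close>; this makes the right-hand side of the equation a genuine integral
  for bounded test functions.\<close>

lemma integrable_mult_norm: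
  fixes u :: "plane \<Rightarrow> 'a::euclidean_space"
  assumes V: "integrable (lebesgue_on D) V" and [measurable]: "u \<in> borel_measurable (lebesgue_on D)"
    and Vu: "integrable (lebesgue_on D) (\<lambda>x. \<bar>V x\<bar> * (norm (u x))\<^sup>2)"
  shows "integrable (lebesgue_on D) (\<lambda>x. \<bar>V x\<bar> * norm (u x))"
proof (rule Bochner_Integration.integrable_bound)
  have [measurable]: "V \<in> borel_measurable (lebesgue_on D)" using V by auto
  show "(\<lambda>x. \<bar>V x\<bar> * norm (u x)) \<in> borel_measurable (lebesgue_on D)" by measurable
  show "integrable (lebesgue_on D) (\<lambda>x. \<bar>V x\<bar> + \<bar>V x\<bar> * (norm (u x))\<^sup>2)"
    using V Vu by auto
  have "r \<le> 1 + r\<^sup>2" for r :: real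
    using sum_squares_bound[of r 1] zero_le_power2[of r] unfolding mult_1_right power_one by linarith
  hence "\<bar>V x\<bar> * norm (u x) \<le> \<bar>V x\<bar> * (1 + (norm (u x))\<^sup>2)" for x
    by (intro mult_left_mono) auto
  thus "AE x in lebesgue_on D. norm (\<bar>V x\<bar> * norm (u x)) \<le> norm (\<bar>V x\<bar> + \<bar>V x\<bar> * (norm (u x))\<^sup>2)"
    by (intro AE_I2) (simp add: algebra_simps)
qed

text \<open>The equation pairs bilinearly, while the \<open>L^2\<close> estimates use the real inner
  product. Testing with \<open>L\<close> composed with \<open>\<phi>\<close> and taking the inner
  product with 1 converts one into the other. Integrability of both sides lets that inner product
  pass through the integrals.\<close>

lemma distributional_solution_inner:
  fixes u :: "plane \<Rightarrow> 'a::{real_normed_field, euclidean_space}"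
  assumes D: "bounded_domain D" and u: "u \<in> W012 D" and sol: "distributional_solution D V u"
    and V: "V \<in> borel_measurable (lebesgue_on D)"
    and Vu: "integrable (lebesgue_on D) (\<lambda>x. \<bar>V x\<bar> * norm (u x))"
    and \<phi>: "\<phi> \<in> test_functions D"
  shows "(\<integral>x. wgrad D u x \<bullet> grad \<phi> x \<partial>lebesgue_on D) = (\<integral>x. V x * (u x \<bullet> \<phi> x) \<partial>lebesgue_on D)"
proof -
  obtain L :: "'a \<Rightarrow> 'a" where L: "bounded_linear L" "\<And>a b. (a * L b) \<bullet> 1 = a \<bullet> b"
    using ex_linear_transpose_mult by blast
  let ?g = "wgrad D u" and ?\<psi> = "\<lambda>x. L (\<phi> x)"
  have g: "?g \<in> L2_space D" "u \<in> L2_space D" using W012_wgrad[OF u] by (auto simp: W012_limit_def)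
  note [measurable] = V L2_spaceD(1)[OF g(1)] L2_spaceD(1)[OF g(2)]
  note s = test_functions_smooth[OF \<phi>]
  have \<psi>: "?\<psi> \<in> test_functions D" by (rule test_functions_linear[OF \<phi> L(1)])
  have grad\<psi>: "grad ?\<psi> x $ i = L (grad \<phi> x $ i)" for x i
    using partial_linear[OF smooth_differentiable[OF s] L(1)] by (simp add: grad_def)
  have G\<psi>: "grad ?\<psi> \<in> L2_space D"
    by (rule grad_in_L2_space[OF D test_functions_smooth[OF \<psi>]])
  have int1: "integrable (lebesgue_on D) (\<lambda>x. \<Sum>i\<in>UNIV. ?g x $ i * grad ?\<psi> x $ i)"
  proof (intro Bochner_Integration.integrable_sum Bochner_Integration.integrable_bound[OF L2_space_integrable_norm_mult[OF g(1) G\<psi>]])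
    note [measurable] = L2_spaceD(1)[OF G\<psi>]
    have [measurable]: "(\<lambda>v::'a^2. v $ i) \<in> borel_measurable borel" for i
      by (intro borel_measurable_continuous_onI continuous_intros)
    show "(\<lambda>x. ?g x $ i * grad ?\<psi> x $ i) \<in> borel_measurable (lebesgue_on D)" for i by measurable
    show "AE x in lebesgue_on D. norm (?g x $ i * grad ?\<psi> x $ i) \<le> norm (norm (?g x) * norm (grad ?\<psi> x))" for i
      by (intro AE_I2) (simp add: norm_mult mult_mono Finite_Cartesian_Product.norm_nth_le)
  qed
  have cont: "continuous_on UNIV ?\<psi>" by (rule smooth_continuous[OF test_functions_smooth[OF \<psi>]])
  have "bounded (?\<psi> ` closure D)"
    using bounded_domain_imp(1)[OF D]
    by (intro compact_imp_bounded compact_continuous_image continuous_on_subset[OF cont]) auto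
  then obtain B where B: "\<And>x. x \<in> closure D \<Longrightarrow> norm (?\<psi> x) \<le> B"
    unfolding bounded_iff by blast
  have int2: "integrable (lebesgue_on D) (\<lambda>x. V x *\<^sub>R (u x * ?\<psi> x))"
  proof (rule Bochner_Integration.integrable_bound)
    show "integrable (lebesgue_on D) (\<lambda>x. B * (\<bar>V x\<bar> * norm (u x)))" using Vu by simp
    have [measurable]: "?\<psi> \<in> borel_measurable (lebesgue_on D)"
      by (rule L2_spaceD(1)[OF smooth_in_L2_space[OF D test_functions_smooth[OF \<psi>]]])
    show "(\<lambda>x. V x *\<^sub>R (u x * ?\<psi> x)) \<in> borel_measurable (lebesgue_on D)" by measurable
    show "AE x in lebesgue_on D. norm (V x *\<^sub>R (u x * ?\<psi> x)) \<le> norm (B * (\<bar>V x\<bar> * norm (u x)))"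
    proof (rule AE_I2)
      fix x assume "x \<in> space (lebesgue_on D)"
      hence "norm (?\<psi> x) \<le> B" using B closure_subset by (auto simp: space_restrict_space)
      hence "norm (?\<psi> x) * (\<bar>V x\<bar> * norm (u x)) \<le> \<bar>B\<bar> * (\<bar>V x\<bar> * norm (u x))"
        by (intro mult_right_mono) auto
      thus "norm (V x *\<^sub>R (u x * ?\<psi> x)) \<le> norm (B * (\<bar>V x\<bar> * norm (u x)))"
        by (simp add: norm_mult abs_mult mult_ac)
    qed
  qed
  have eq: "(\<integral>x. (\<Sum>i\<in>UNIV. ?g x $ i * grad ?\<psi> x $ i) \<partial>lebesgue_on D) =
      (\<integral>x. V x *\<^sub>R (u x * ?\<psi> x) \<partial>lebesgue_on D)"
    using sol \<psi> by (simp add: distributional_solution_def)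
  have "(\<integral>x. ?g x \<bullet> grad \<phi> x \<partial>lebesgue_on D) =
      (\<integral>x. (\<Sum>i\<in>UNIV. ?g x $ i * grad ?\<psi> x $ i) \<bullet> 1 \<partial>lebesgue_on D)"
    by (simp add: inner_vec_def inner_sum_left grad\<psi> L(2))
  also have "\<dots> = (\<integral>x. (V x *\<^sub>R (u x * ?\<psi> x)) \<bullet> 1 \<partial>lebesgue_on D)"
    using integral_inner_left[OF int1, of 1] integral_inner_left[OF int2, of 1] eq by simp
  also have "\<dots> = (\<integral>x. V x * (u x \<bullet> \<phi> x) \<partial>lebesgue_on D)"
    by (simp add: L(2))
  finally show ?thesis .
qed

text \<open>The equation is tested with approximating test functions. The gradient side converges by
  Cauchy--Schwarz; on the other side the error is the integral of \<open>V\<close> times the inner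
  product of \<open>u\<close> with \<open>\<phi> n - u\<close>, which
  \<open>integral_weighted_square\<close> with weight \<open>|V|\<close> makes small.\<close>

lemma energy_identity:
  fixes u :: "plane \<Rightarrow> 'a::{real_normed_field, euclidean_space}"
  assumes D: "bounded_domain D"
    and MT: "\<And>w::plane \<Rightarrow> 'a. w \<in> W012 D \<Longrightarrow> nontrivial D w \<Longrightarrow> MT_integral D w \<le> ennreal A"
    and A: "A \<ge> 0" and V: "V \<in> LlogL D"
    and u: "u \<in> W012 D" and sol: "distributional_solution D V u"
  shows "integrable (lebesgue_on D) (\<lambda>x. V x * (norm (u x))\<^sup>2)"
    and "(dirichlet_norm D u)\<^sup>2 = (\<integral>x. V x * (norm (u x))\<^sup>2 \<partial>lebesgue_on D)"
proof -
  let ?g = "wgrad D u"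
  note lim = W012_wgrad[OF u]
  obtain \<phi> where \<phi>: "u \<in> L2_space D" "?g \<in> L2_space D" "\<And>n. \<phi> n \<in> test_functions D"
    "(\<lambda>n. L2_norm D (\<lambda>x. \<phi> n x - u x)) \<longlonglongrightarrow> 0"
    "(\<lambda>n. L2_norm D (\<lambda>x. grad (\<phi> n) x - ?g x)) \<longlonglongrightarrow> 0"
    using lim by (rule W012_limitE) blast
  note s = test_functions_smooth[OF \<phi>(3)]
  note Vint = LlogL_integrable(1)[OF V]
  have N: "integrable (lebesgue_on D) (\<lambda>x. young_N (\<bar>V x\<bar> / 1))" using LlogL_integrable(2)[OF V, of 1] by simp
  have [measurable]: "V \<in> borel_measurable (lebesgue_on D)" using Vint by auto
  note [measurable] = L2_spaceD(1)[OF \<phi>(1)] L2_spaceD(1)[OF smooth_in_L2_space[OF D s]]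
  define B where "B = 1 / (4 * pi) * ((\<integral>x. young_N (\<bar>V x\<bar> / 1) \<partial>lebesgue_on D) + A)"
  have weighted: "integrable (lebesgue_on D) (\<lambda>x. \<bar>V x\<bar> * (norm (w x))\<^sup>2)"
      "(\<integral>x. \<bar>V x\<bar> * (norm (w x))\<^sup>2 \<partial>lebesgue_on D) \<le> k\<^sup>2 * B"
    if "W012_limit D w h" "L2_norm D h \<le> k" "k > 0" for w :: "plane \<Rightarrow> 'a" and h k
    using integral_weighted_square[OF D MT A that _ _ _ N] unfolding B_def by simp_all
  have Vu2: "integrable (lebesgue_on D) (\<lambda>x. \<bar>V x\<bar> * (norm (u x))\<^sup>2)"
    by (rule weighted(1)[OF lim, of "L2_norm D ?g + 1"]) (simp_all add: add_nonneg_pos)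
  show Vu2': "integrable (lebesgue_on D) (\<lambda>x. V x * (norm (u x))\<^sup>2)"
    by (rule Bochner_Integration.integrable_bound[OF Vu2]) (auto simp: abs_mult)
  have eq: "(\<integral>x. ?g x \<bullet> grad (\<phi> n) x \<partial>lebesgue_on D) = (\<integral>x. V x * (u x \<bullet> \<phi> n x) \<partial>lebesgue_on D)" for n
    by (rule distributional_solution_inner[OF D u sol _ integrable_mult_norm[OF Vint _ Vu2] \<phi>(3)]) measurable
  \<comment> \<open>The added \<open>1 / real (Suc n)\<close> keeps the scale strictly positive even
    if the gradients agree, and \<open>k\<close> still tends to 0.\<close>
  define k where "k n = L2_norm D (\<lambda>x. grad (\<phi> n) x - ?g x) + 1 / real (Suc n)" for n
  have k: "k n > 0" "L2_norm D (\<lambda>x. grad (\<phi> n) x - ?g x) \<le> k n" for n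
    by (simp_all add: k_def add_nonneg_pos)
  have "(\<lambda>n. L2_norm D (\<lambda>x. grad (\<phi> n) x - ?g x) + 1 / real (Suc n)) \<longlonglongrightarrow> 0 + 0"
    by (intro tendsto_add \<phi>(5)) (use LIMSEQ_inverse_real_of_nat in \<open>simp add: inverse_eq_divide\<close>)
  hence k0: "k \<longlonglongrightarrow> 0" by (simp add: k_def[abs_def])
  define I where "I = (\<integral>x. V x * (norm (u x))\<^sup>2 \<partial>lebesgue_on D)"
  define J where "J = (\<integral>x. \<bar>V x\<bar> * (norm (u x))\<^sup>2 \<partial>lebesgue_on D)"
  have bound: "\<bar>(\<integral>x. V x * (u x \<bullet> \<phi> n x) \<partial>lebesgue_on D) - I\<bar> \<le> k n * ((J + B) / 2)" for n
  proof -
    define w where "w x = \<phi> n x - u x" for x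
    have [measurable]: "w \<in> borel_measurable (lebesgue_on D)" unfolding w_def[abs_def] by measurable
    have wlim: "W012_limit D w (\<lambda>x. grad (\<phi> n) x - ?g x)"
      unfolding w_def by (rule W012_limit_diff[OF D W012_limit_test[OF D \<phi>(3)] lim])
    note W = weighted[OF wlim k(2,1)]
    \<comment> \<open>Arithmetic-geometric mean with weight \<open>k n\<close>. The weighted square
      of \<open>w\<close> is at most \<open>(k n)^2 * B\<close>, so after integration both summands
      are bounded by constants times \<open>k n\<close>.\<close>
    let ?b = "\<lambda>x. (k n / 2) * (\<bar>V x\<bar> * (norm (u x))\<^sup>2) + 1 / (2 * k n) * (\<bar>V x\<bar> * (norm (w x))\<^sup>2)"
    have le: "\<bar>V x * (u x \<bullet> w x)\<bar> \<le> ?b x" for x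
    proof -
      have "2 * (k n * norm (u x)) * norm (w x) \<le> (k n * norm (u x))\<^sup>2 + (norm (w x))\<^sup>2"
        by (rule sum_squares_bound)
      hence "norm (u x) * norm (w x) \<le> (k n / 2) * (norm (u x))\<^sup>2 + 1 / (2 * k n) * (norm (w x))\<^sup>2"
        using k(1)[of n] by (simp add: field_simps power2_eq_square)
      hence "\<bar>u x \<bullet> w x\<bar> \<le> (k n / 2) * (norm (u x))\<^sup>2 + 1 / (2 * k n) * (norm (w x))\<^sup>2"
        using Cauchy_Schwarz_ineq2[of "u x" "w x"] by linarith
      hence "\<bar>V x\<bar> * \<bar>u x \<bullet> w x\<bar> \<le> \<bar>V x\<bar> * ((k n / 2) * (norm (u x))\<^sup>2 + 1 / (2 * k n) * (norm (w x))\<^sup>2)"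
        by (intro mult_left_mono) auto
      thus ?thesis by (simp add: abs_mult algebra_simps)
    qed
    have bint: "integrable (lebesgue_on D) ?b"
      using Vu2 W(1) by (intro Bochner_Integration.integrable_add integrable_mult_right)
    have int: "integrable (lebesgue_on D) (\<lambda>x. V x * (u x \<bullet> w x))"
    proof (rule Bochner_Integration.integrable_bound[OF bint])
      show "AE x in lebesgue_on D. norm (V x * (u x \<bullet> w x)) \<le> norm (?b x)"
      proof (rule AE_I2)
        fix x
        show "norm (V x * (u x \<bullet> w x)) \<le> norm (?b x)"
          unfolding real_norm_def by (rule order_trans[OF le abs_ge_self])
      qed
    qed measurable
    have split: "V x * (u x \<bullet> \<phi> n x) = V x * (u x \<bullet> w x) + V x * (norm (u x))\<^sup>2" for x
      by (simp add: w_def inner_diff_right power2_norm_eq_inner algebra_simps)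
    have "(\<integral>x. V x * (u x \<bullet> \<phi> n x) \<partial>lebesgue_on D) - I = (\<integral>x. V x * (u x \<bullet> w x) \<partial>lebesgue_on D)"
      unfolding split I_def using int Vu2' by simp
    also have "\<bar>\<dots>\<bar> \<le> (\<integral>x. ?b x \<partial>lebesgue_on D)"
      using integral_abs_bound[of "lebesgue_on D" "\<lambda>x. V x * (u x \<bullet> w x)"]
        integral_mono[OF integrable_abs[OF int] bint le] by linarith
    also have "\<dots> = (k n / 2) * J + 1 / (2 * k n) * (\<integral>x. \<bar>V x\<bar> * (norm (w x))\<^sup>2 \<partial>lebesgue_on D)"
      unfolding J_def using Vu2 W(1)
      by (subst Bochner_Integration.integral_add) (simp_all only: integrable_mult_right integral_mult_right_zero)
    also have "\<dots> \<le> (k n / 2) * J + 1 / (2 * k n) * ((k n)\<^sup>2 * B)"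
      using W(2) k(1)[of n] by (intro add_left_mono mult_left_mono) auto
    also have "\<dots> = k n * ((J + B) / 2)"
      using k(1)[of n] by (simp add: field_simps power2_eq_square)
    finally show ?thesis .
  qed
  have "(\<lambda>n. (\<integral>x. V x * (u x \<bullet> \<phi> n x) \<partial>lebesgue_on D) - I) \<longlonglongrightarrow> 0"
    using bound tendsto_mult_left_zero[OF k0] by (rule real_null_comparison)
  hence 1: "(\<lambda>n. \<integral>x. V x * (u x \<bullet> \<phi> n x) \<partial>lebesgue_on D) \<longlonglongrightarrow> I" by (rule LIM_zero_cancel)
  have "(\<lambda>n. \<integral>x. grad (\<phi> n) x \<bullet> ?g x \<partial>lebesgue_on D) \<longlonglongrightarrow> (\<integral>x. ?g x \<bullet> ?g x \<partial>lebesgue_on D)"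
    by (rule L2_inner_tendsto[OF grad_in_L2_space[OF D s] \<phi>(2) \<phi>(2) \<phi>(5)])
  hence "(\<lambda>n. \<integral>x. V x * (u x \<bullet> \<phi> n x) \<partial>lebesgue_on D) \<longlonglongrightarrow> (\<integral>x. ?g x \<bullet> ?g x \<partial>lebesgue_on D)"
    by (simp add: eq[symmetric] inner_commute)
  from LIMSEQ_unique[OF this 1] show "(dirichlet_norm D u)\<^sup>2 = (\<integral>x. V x * (norm (u x))\<^sup>2 \<partial>lebesgue_on D)"
    by (simp add: I_def dirichlet_norm_def L2_norm_power2 power2_norm_eq_inner)
qed

section \<open>Bounds for the L log L norm and the extremal potential\<close>

text \<open>The squared Dirichlet norm appears on both sides of the weighted estimate and cancels;
  what remains is a lower bound for every competitor in the infimum. Asking only for the energy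
  inequality \<open>le\<close>, instead of the equation, lets the lemma serve both the positive part
  of a potential and the extremal potential.\<close>

lemma LlogL_norm_lower_bound:
  fixes u :: "plane \<Rightarrow> 'a::euclidean_space"
  assumes D: "bounded_domain D"
    and MT: "\<And>w::plane \<Rightarrow> 'a. w \<in> W012 D \<Longrightarrow> nontrivial D w \<Longrightarrow>
      MT_integral D w \<le> ennreal (C * measure lebesgue D)"
    and C: "C * measure lebesgue D > 0" and u: "u \<in> W012 D" and d: "dirichlet_norm D u > 0"
    and f: "f \<in> LlogL D" and f0: "\<And>x. f x \<ge> 0"
    and le: "(dirichlet_norm D u)\<^sup>2 \<le> (\<integral>x. f x * (norm (u x))\<^sup>2 \<partial>lebesgue_on D)"
    and t: "t > 0"
  shows "4 * pi / (C * measure lebesgue D) \<le>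
    t + t / (C * measure lebesgue D) * (\<integral>x. young_N (\<bar>f x\<bar> / t) \<partial>lebesgue_on D)"
proof -
  let ?A = "C * measure lebesgue D" and ?I = "\<integral>x. young_N (\<bar>f x\<bar> / t) \<partial>lebesgue_on D"
  let ?d = "dirichlet_norm D u"
  have m: "f \<in> borel_measurable (lebesgue_on D)" using f by (simp add: LlogL_def)
  have N: "integrable (lebesgue_on D) (\<lambda>x. young_N (f x / t))"
    using LlogL_integrable(2)[OF f t] f0 by simp
  have "?d\<^sup>2 \<le> ?d\<^sup>2 * (t / (4 * pi) * (?I + ?A))"
    using integral_weighted_square(2)[OF D MT less_imp_le[OF C] W012_wgrad[OF u] _ d m f0 t N] le f0
    by (simp add: dirichlet_norm_def)
  hence "?d\<^sup>2 * 1 \<le> ?d\<^sup>2 * (t / (4 * pi) * (?I + ?A))" by simp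
  hence "1 \<le> t / (4 * pi) * (?I + ?A)"
    using d by (simp only: mult_le_cancel_left_pos zero_less_power)
  hence "4 * pi \<le> t * (?I + ?A)" by (simp add: field_simps)
  hence "4 * pi / ?A \<le> t * (?I + ?A) / ?A" using C by (intro divide_right_mono) auto
  also have "\<dots> = t + t / ?A * ?I"
    using nonzero_mult_div_cancel_right[of ?A t] C by (simp only: add_divide_distrib distrib_left) simp
  finally show ?thesis .
qed

text \<open>Write \<open>b = 4 * pi * |u|^2\<close>. Since \<open>ln V = b - ln S\<close>, both the
  integrand of \<open>S\<close> and the L log L integrand of the potential are at most constants
  times \<open>exp b * (1 + b)\<close>, which is below \<open>exp (2 * b)\<close>. Exponential
  integrability is therefore needed at \<open>8 * pi\<close>, twice the critical exponent.\<close>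

lemma extremal_potential_properties:
  fixes u :: "plane \<Rightarrow> 'a::euclidean_space"
  assumes D: "bounded_domain D"
    and MT: "\<And>w::plane \<Rightarrow> 'a. w \<in> W012 D \<Longrightarrow> nontrivial D w \<Longrightarrow> MT_integral D w \<le> ennreal A"
    and A: "A \<ge> 0" and u: "u \<in> W012 D" and nt: "nontrivial D u"
  defines "S \<equiv> \<integral>x. (norm (u x))\<^sup>2 * exp (4 * pi * (norm (u x))\<^sup>2) \<partial>lebesgue_on D"
  shows "S > 0"
    and "integrable (lebesgue_on D) (\<lambda>x. (norm (u x))\<^sup>2 * exp (4 * pi * (norm (u x))\<^sup>2))"
    and "extremal_potential D u \<in> LlogL D"
proof -
  let ?b = "\<lambda>x. 4 * pi * (norm (u x))\<^sup>2"
  have [measurable]: "u \<in> borel_measurable (lebesgue_on D)"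
    using W012_wgrad[OF u] by (auto simp: W012_limit_def L2_space_def)
  have dbl: "exp (8 * pi * (norm (u x))\<^sup>2) = exp (?b x) * exp (?b x)" for x
    by (simp add: exp_add[symmetric])
  have int2: "integrable (lebesgue_on D) (\<lambda>x. exp (?b x) * exp (?b x))"
    using exp_square_integrable[OF D MT A u, of "8 * pi"] by (simp only: dbl) simp
  have int1b: "integrable (lebesgue_on D) (\<lambda>x. exp (?b x) * (1 + ?b x))"
  proof (rule Bochner_Integration.integrable_bound[OF int2])
    show "AE x in lebesgue_on D. norm (exp (?b x) * (1 + ?b x)) \<le> norm (exp (?b x) * exp (?b x))"
    proof (rule AE_I2)
      fix x
      have "0 \<le> ?b x" by simp
      thus "norm (exp (?b x) * (1 + ?b x)) \<le> norm (exp (?b x) * exp (?b x))"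
        using exp_ge_add_one_self[of "?b x"] by (simp add: abs_mult)
    qed
  qed measurable
  show int: "integrable (lebesgue_on D) (\<lambda>x. (norm (u x))\<^sup>2 * exp (?b x))"
  proof (rule Bochner_Integration.integrable_bound)
    show "integrable (lebesgue_on D) (\<lambda>x. 1 / (4 * pi) * (exp (?b x) * (1 + ?b x)))"
      using int1b by (rule integrable_mult_right)
    show "AE x in lebesgue_on D. norm ((norm (u x))\<^sup>2 * exp (?b x)) \<le>
        norm (1 / (4 * pi) * (exp (?b x) * (1 + ?b x)))"
    proof (rule AE_I2)
      fix x
      have "(norm (u x))\<^sup>2 * exp (?b x) = 1 / (4 * pi) * (exp (?b x) * ?b x)" by simp
      also have "\<dots> \<le> 1 / (4 * pi) * (exp (?b x) * (1 + ?b x))" by (intro mult_left_mono) auto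
      finally have "(norm (u x))\<^sup>2 * exp (?b x) \<le> 1 / (4 * pi) * (exp (?b x) * (1 + ?b x))" .
      moreover have "0 \<le> (norm (u x))\<^sup>2 * exp (?b x)" by simp
      ultimately show "norm ((norm (u x))\<^sup>2 * exp (?b x)) \<le> norm (1 / (4 * pi) * (exp (?b x) * (1 + ?b x)))"
        unfolding real_norm_def by linarith
    qed
  qed measurable
  \<comment> \<open>The integrand is nonnegative and vanishes only where \<open>u\<close>
    does.\<close>
  have "S \<noteq> 0"
    using integral_nonneg_eq_0_iff_AE[OF int] nt by (auto simp: S_def nontrivial_def)
  moreover have "S \<ge> 0" unfolding S_def by (intro integral_nonneg_AE) simp
  ultimately show S: "S > 0" by simp
  let ?V = "extremal_potential D u"
  have V: "?V x = exp (?b x) / S" for x by (simp add: extremal_potential_def S_def)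
  have mV [measurable]: "?V \<in> borel_measurable (lebesgue_on D)" unfolding V by measurable
  have "integrable (lebesgue_on D) (\<lambda>x. \<bar>?V x\<bar> * (1 + max 0 (ln \<bar>?V x\<bar>)))"
  proof (rule Bochner_Integration.integrable_bound)
    show "integrable (lebesgue_on D) (\<lambda>x. (1 + \<bar>ln S\<bar>) / S * (exp (?b x) * (1 + ?b x)))"
      using int1b by (rule integrable_mult_right)
    show "AE x in lebesgue_on D. norm (\<bar>?V x\<bar> * (1 + max 0 (ln \<bar>?V x\<bar>))) \<le>
        norm ((1 + \<bar>ln S\<bar>) / S * (exp (?b x) * (1 + ?b x)))"
    proof (rule AE_I2)
      fix x
      have b: "0 \<le> ?b x" by simp
      have "1 + max 0 (?b x - ln S) \<le> 1 + ?b x + \<bar>ln S\<bar>" using b by linarith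
      also have "\<dots> \<le> (1 + \<bar>ln S\<bar>) * (1 + ?b x)"
        using mult_nonneg_nonneg[OF abs_ge_zero[of "ln S"] b] unfolding ring_distribs by linarith
      finally have "\<bar>?V x\<bar> * (1 + max 0 (?b x - ln S)) \<le> \<bar>?V x\<bar> * ((1 + \<bar>ln S\<bar>) * (1 + ?b x))"
        by (intro mult_left_mono) auto
      also have "?b x - ln S = ln \<bar>?V x\<bar>" using S by (simp add: V ln_div)
      also have "\<bar>?V x\<bar> * ((1 + \<bar>ln S\<bar>) * (1 + ?b x)) = (1 + \<bar>ln S\<bar>) / S * (exp (?b x) * (1 + ?b x))"
        using S by (simp add: V)
      finally have *: "\<bar>?V x\<bar> * (1 + max 0 (ln \<bar>?V x\<bar>)) \<le> (1 + \<bar>ln S\<bar>) / S * (exp (?b x) * (1 + ?b x))" .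
      have "norm (\<bar>?V x\<bar> * (1 + max 0 (ln \<bar>?V x\<bar>))) = \<bar>?V x\<bar> * (1 + max 0 (ln \<bar>?V x\<bar>))" by simp
      with order_trans[OF * abs_ge_self]
      show "norm (\<bar>?V x\<bar> * (1 + max 0 (ln \<bar>?V x\<bar>))) \<le>
          norm ((1 + \<bar>ln S\<bar>) / S * (exp (?b x) * (1 + ?b x)))"
        by (simp only: real_norm_def)
    qed
  qed measurable
  thus "?V \<in> LlogL D" using mV by (simp add: LlogL_def)
qed

lemma one_le_LlogL_norm:
  assumes "C * measure lebesgue D > 0"
    and "\<And>t. t > 0 \<Longrightarrow> 4 * pi / (C * measure lebesgue D) \<le>
      t + t / (C * measure lebesgue D) * (\<integral>x. young_N (\<bar>f x\<bar> / t) \<partial>lebesgue_on D)"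
  shows "1 \<le> C * measure lebesgue D / (4 * pi) * LlogL_norm C D f"
proof -
  have "4 * pi / (C * measure lebesgue D) \<le> LlogL_norm C D f"
    unfolding LlogL_norm_def using assms(2) by (intro cINF_greatest) auto
  hence "C * measure lebesgue D / (4 * pi) * (4 * pi / (C * measure lebesgue D))
      \<le> C * measure lebesgue D / (4 * pi) * LlogL_norm C D f"
    using assms(1) by (intro mult_left_mono) auto
  moreover have "C * measure lebesgue D / (4 * pi) * (4 * pi / (C * measure lebesgue D)) = 1"
  proof -
    have "a / (4 * pi) * (4 * pi / a) = 1" if "a > 0" for a :: real using that by simp
    thus ?thesis using assms(1) .
  qed
  ultimately show ?thesis by linarith
qed

theorem theorem1p4:
  fixes D :: "plane set" and C\<^sub>2 :: real
  assumes domain: "bounded_domain D"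
    and moser_trudinger:
      "\<And>(\<Omega> :: plane set) (w :: plane \<Rightarrow> 'a::{real_normed_field, euclidean_space}).
         bounded_domain \<Omega> \<Longrightarrow> w \<in> W012 \<Omega> \<Longrightarrow> nontrivial \<Omega> w \<Longrightarrow>
         MT_integral \<Omega> w \<le> ennreal (C\<^sub>2 * measure lebesgue \<Omega>)"
  shows "(\<forall>V \<in> LlogL D.
            (\<exists>u :: plane \<Rightarrow> 'a. u \<in> W012 D \<and> nontrivial D u \<and> distributional_solution D V u) \<longrightarrow>
            C\<^sub>2 * measure lebesgue D / (4 * pi) * LlogL_norm C\<^sub>2 D (pos_part V) \<ge> 1) \<and>
         (\<forall>u :: plane \<Rightarrow> 'a.
            MT_extremal C\<^sub>2 D u \<and> dirichlet_norm D u = 1 \<longrightarrow>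
            C\<^sub>2 * measure lebesgue D / (4 * pi) *
              LlogL_norm C\<^sub>2 D (pos_part (extremal_potential D u)) = 1)"
proof (intro conjI ballI allI impI)
  let ?A = "C\<^sub>2 * measure lebesgue D"
  note MT = moser_trudinger[OF domain]
  have A: "?A > 0" if "u \<in> W012 D" "nontrivial D u" for u :: "plane \<Rightarrow> 'a"
  proof -
    have "0 < ennreal ?A"
      using MT_integral_pos(2)[OF domain that] MT[OF that] by (rule less_le_trans)
    thus ?thesis by simp
  qed
  {
    fix V assume V: "V \<in> LlogL D"
      and "\<exists>u :: plane \<Rightarrow> 'a. u \<in> W012 D \<and> nontrivial D u \<and> distributional_solution D V u"
    then obtain u :: "plane \<Rightarrow> 'a" where u: "u \<in> W012 D" and nt: "nontrivial D u"
      and sol: "distributional_solution D V u" by blast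
    note A = A[OF u nt]
    note E = energy_identity[OF domain MT less_imp_le[OF A] V u sol]
    have P: "pos_part V \<in> LlogL D" by (rule pos_part_LlogL[OF V])
    have P0: "pos_part V x \<ge> 0" for x by (simp add: pos_part_def)
    have "integrable (lebesgue_on D) (\<lambda>x. young_N (pos_part V x / 1))"
      using LlogL_integrable(2)[OF P, of 1] P0 by simp
    moreover have "pos_part V \<in> borel_measurable (lebesgue_on D)" using P by (simp add: LlogL_def)
    moreover have "L2_norm D (wgrad D u) \<le> L2_norm D (wgrad D u) + 1" "0 < L2_norm D (wgrad D u) + 1"
      by (simp_all add: add_nonneg_pos)
    \<comment> \<open>Needed to compare the integrals with \<open>V\<close> and
      \<open>pos_part V\<close>: monotonicity of the Bochner integral requires both to be
      integrable. Any scales would do; \<open>k\<close> is the gradient norm plus 1 and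
      \<open>t\<close> is 1.\<close>
    ultimately have "integrable (lebesgue_on D) (\<lambda>x. pos_part V x * (norm (u x))\<^sup>2)"
      using integral_weighted_square(1)[OF domain MT less_imp_le[OF A] W012_wgrad[OF u],
          of "L2_norm D (wgrad D u) + 1" "pos_part V" 1] P0
      by simp
    hence "(\<integral>x. V x * (norm (u x))\<^sup>2 \<partial>lebesgue_on D) \<le> (\<integral>x. pos_part V x * (norm (u x))\<^sup>2 \<partial>lebesgue_on D)"
      using E(1) by (intro integral_mono mult_right_mono) (auto simp: pos_part_def)
    hence "(dirichlet_norm D u)\<^sup>2 \<le> (\<integral>x. pos_part V x * (norm (u x))\<^sup>2 \<partial>lebesgue_on D)"
      by (simp add: E(2))
    thus "1 \<le> ?A / (4 * pi) * LlogL_norm C\<^sub>2 D (pos_part V)"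
      by (intro one_le_LlogL_norm A LlogL_norm_lower_bound[OF domain MT A u MT_integral_pos(1)[OF domain u nt] P P0])
  }
  {
    fix u :: "plane \<Rightarrow> 'a" assume ext: "MT_extremal C\<^sub>2 D u \<and> dirichlet_norm D u = 1"
    hence u: "u \<in> W012 D" and nt: "nontrivial D u" and d: "dirichlet_norm D u = 1"
      and eq: "MT_integral D u = ennreal ?A" by (auto simp: MT_extremal_def)
    note A = A[OF u nt]
    note L = extremal_potential_properties[OF domain MT less_imp_le[OF A] u nt]
    let ?b = "\<lambda>x. 4 * pi * (norm (u x))\<^sup>2" and ?V = "extremal_potential D u"
    define S where "S = (\<integral>x. (norm (u x))\<^sup>2 * exp (?b x) \<partial>lebesgue_on D)"
    have S: "S > 0" using L(1) by (simp add: S_def)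
    have V: "?V x = exp (?b x) / S" for x by (simp add: extremal_potential_def S_def)
    have V0: "?V x \<ge> 0" for x using S by (simp add: V)
    have pp: "pos_part ?V = ?V" using V0 by (simp add: pos_part_def fun_eq_iff max_absorb1)
    have "?V x * (norm (u x))\<^sup>2 = (norm (u x))\<^sup>2 * exp (?b x) / S" for x by (simp add: V)
    hence "(\<integral>x. ?V x * (norm (u x))\<^sup>2 \<partial>lebesgue_on D) = 1"
      using S by (simp add: S_def[symmetric])
    hence le: "(dirichlet_norm D u)\<^sup>2 \<le> (\<integral>x. ?V x * (norm (u x))\<^sup>2 \<partial>lebesgue_on D)" by (simp add: d)
    have lower: "4 * pi / ?A \<le> t + t / ?A * (\<integral>x. young_N (\<bar>?V x\<bar> / t) \<partial>lebesgue_on D)" if "t > 0" for t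
      using LlogL_norm_lower_bound[OF domain MT A u MT_integral_pos(1)[OF domain u nt] L(3) V0 le that] .
    have lim: "W012_limit D u (wgrad D u)" "L2_norm D (wgrad D u) \<le> 1"
      using W012_wgrad[OF u] d by (simp_all add: dirichlet_norm_def)
    note E = MT_scaled[OF domain MT less_imp_le[OF A] lim, simplified]
    have "ennreal (\<integral>x. exp (?b x) - 1 \<partial>lebesgue_on D) = ennreal ?A"
      using eq nn_integral_eq_integral[OF E(1)] by (simp add: MT_integral_def d)
    \<comment> \<open>Extremality as an equation between reals; injectivity of
      \<open>ennreal\<close> needs both values to be nonnegative.\<close>
    hence intE: "(\<integral>x. exp (?b x) - 1 \<partial>lebesgue_on D) = ?A"
      using A by (subst (asm) ennreal_inj) (auto intro!: integral_nonneg_AE)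
    \<comment> \<open>At scale \<open>1 / S\<close> the potential becomes \<open>exp b\<close> with
      \<open>b\<close> the Moser--Trudinger exponent, so Young's inequality is an equality at every
      point.\<close>
    have "\<bar>?V x\<bar> / (1 / S) = exp (?b x)" for x using S by (simp add: V)
    hence "young_N (\<bar>?V x\<bar> / (1 / S)) = 4 * pi * ((norm (u x))\<^sup>2 * exp (?b x)) - (exp (?b x) - 1)" for x
      using young_N_exp[of "?b x"] by simp
    hence N: "(\<integral>x. young_N (\<bar>?V x\<bar> / (1 / S)) \<partial>lebesgue_on D) = 4 * pi * S - ?A"
      using L(2) E(1) intE by (simp add: S_def)
    \<comment> \<open>A real infimum lies below its members only if the set is bounded below;
      \<open>lower\<close> provides that bound, and it is also the value attained here. The term
      \<open>- ?A\<close> in \<open>N\<close> cancels the leading \<open>1 / S\<close>.\<close>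
    have "LlogL_norm C\<^sub>2 D ?V \<le> 1 / S + 1 / S / ?A * (\<integral>x. young_N (\<bar>?V x\<bar> / (1 / S)) \<partial>lebesgue_on D)"
      unfolding LlogL_norm_def
      by (rule cINF_lower[OF bdd_belowI2[where m = "4 * pi / ?A"]]) (use lower S in auto)
    also have "\<dots> = 4 * pi / ?A"
    proof -
      have "1 / S + 1 / S / a * (4 * pi * S - a) = 4 * pi / a" if "a > 0" for a
        using that S by (simp add: field_simps)
      thus ?thesis unfolding N using A .
    qed
    finally have "?A / (4 * pi) * LlogL_norm C\<^sub>2 D ?V \<le> ?A / (4 * pi) * (4 * pi / ?A)"
      using A by (intro mult_left_mono) auto
    also have "\<dots> = 1"
    proof -
      have "a / (4 * pi) * (4 * pi / a) = 1" if "a > 0" for a :: real using that by simp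
      thus ?thesis using A .
    qed
    finally have "?A / (4 * pi) * LlogL_norm C\<^sub>2 D ?V \<le> 1" .
    moreover have "1 \<le> ?A / (4 * pi) * LlogL_norm C\<^sub>2 D ?V"
      by (rule one_le_LlogL_norm[OF A lower])
    ultimately show "?A / (4 * pi) * LlogL_norm C\<^sub>2 D (pos_part ?V) = 1"
      unfolding pp by (rule order_antisym)
  }
qed

end
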